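(* Let $\omega$ be a non-quasianalytic weight function. Then $M(\mathcal{O}'_{M,\omega}(\mathbb{R}^N))=\mathcal{O}_{M,\omega}(\mathbb{R}^N)$ and $M(\mathcal{O}'_{C,\omega}(\mathbb{R}^N))=\mathcal{O}_{C,\omega}(\mathbb{R}^N)$, where $M(E')$ denotes the space of multipliers of the strong dual $E'$.
   Context: Weights. A non-quasianalytic weight function is a continuous increasing function $\omega:[0,\infty)\to[0,\infty)$ such that: ($\alpha$) there is $K\ge 1$ with $\omega(2t)\le K(1+\omega(t))$ for all $t\ge 0$; ($\beta$) $\int_1^\infty \frac{\omega(t)}{1+t^2}\,dt<\infty$; ($\gamma$) there are $a\in\mathbb{R}$, $b>0$ with $\omega(t)\ge a+b\log(1+t)$ for all $t\ge 0$; ($\delta$) $\varphi_\omega(t)=\omega(e^t)$ is convex. It is assumed (normalization) that $\omega$ vanishes on $[0,1]$. For $x\in\mathbb{R}^N$, $\omega(x):=\omega(|x|)$. The Young conjugate is $\varphi^*_\omega(s):=\sup_{t\ge 0}\{st-\varphi_\omega(t)\}$, $s\ge 0$ (the value $+\infty$ is allowed, with $\exp(-\infty)=0$). Spaces. $\mathcal{E}_\omega(\mathbb{R}^N)$ is the space of $\omega$-ultradifferentiable functions: all $f\in C^\infty(\mathbb{R}^N)$ with $p_{K,m}(f):=\sup_{x\in K}\sup_{\alpha\in\mathbb{N}_0^N}|\partial^\alpha f(x)|\exp\left(-m\varphi^*_\omega\left(\frac{|\alpha|}{m}\right)\right)<\infty$ for all compact $K\subset\mathbb{R}^N$ and $m\in\mathbb{N}$,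 topologized by the seminorms $p_{K,m}$. For $m,n\in\mathbb{N}$ let $\mathcal{O}^m_{n,\omega}(\mathbb{R}^N)$ be the space of all $f\in C^\infty(\mathbb{R}^N)$ with $r_{m,n}(f):=\sup_{\alpha\in\mathbb{N}_0^N}\sup_{x\in\mathbb{R}^N}|\partial^\alpha f(x)|\exp\left(-n\omega(x)-m\varphi^*_\omega\left(\frac{|\alpha|}{m}\right)\right)<\infty$, with norm $r_{m,n}$. Set $\mathcal{O}_{M,\omega}(\mathbb{R}^N):=\bigcap_{m}\bigcup_{n}\mathcal{O}^m_{n,\omega}(\mathbb{R}^N)$ with the topology of the projective limit over $m$ of the locally convex inductive limits $\mathrm{ind}_{n}\,\mathcal{O}^m_{n,\omega}(\mathbb{R}^N)$, and $\mathcal{O}_{C,\omega}(\mathbb{R}^N):=\bigcup_{n}\bigcap_{m}\mathcal{O}^m_{n,\omega}(\mathbb{R}^N)$ with the topology of the locally convex inductive limit over $n$ of the projective limits $\mathrm{proj}_m\,\mathcal{O}^m_{n,\omega}(\mathbb{R}^N)$. Both are continuously included in $\mathcal{E}_\omega(\mathbb{R}^N)$ with dense range. A prime denotes the strong dual. Multipliers of duals. For a locally convex Hausdorff space $E$ of $\omega$-ultradifferentiable functions on $\mathbb{R}^N$ continuously included in $\mathcal{E}_\omega(\mathbb{R}^N)$ with dense range, with strong dual $E'$, $M(E')$ is the largest space such that (1) for all $T\in E'$ and $f\in M(E')$, $fT$ is well-defined on $E$ and belongs to $E'$; (2) for all $f\in M(E')$ the operator $M_f:E'\to E'$, $T\mapsto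 fT$, is continuous. Here the product of an $\omega$-ultradistribution $T$ with an $\omega$-ultradifferentiable function $f\in\mathcal{E}_\omega(\mathbb{R}^N)$ is defined by transposition, $\langle fT,g\rangle:=\langle T,fg\rangle$ for $g\in E$ (so that $fT$ being well-defined on $E$ requires $fg\in E$ for all $g\in E$). *)

theory Defs
  imports "HOL-Analysis.Analysis" "HOL-Library.Function_Algebras"
begin

section \<open>Weight functions\<close>

(* The values of \<omega> on negative arguments are irrelevant. *)
definition nonquasianalytic_weight :: "(real \<Rightarrow> real) \<Rightarrow> bool" where
  "nonquasianalytic_weight \<omega> \<longleftrightarrow>
     continuous_on {0..} \<omega> \<and> mono_on {0..} \<omega> \<and> (\<forall>t\<ge>0. 0 \<le> \<omega> t) \<and>
     (\<exists>K\<ge>1. \<forall>t\<ge>0. \<omega> (2 * t) \<le> K * (1 + \<omega> t)) \<and>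
     set_integrable lborel {1..} (\<lambda>t. \<omega> t / (1 + t\<^sup>2)) \<and>
     (\<exists>a b. b > 0 \<and> (\<forall>t\<ge>0. a + b * ln (1 + t) \<le> \<omega> t)) \<and>
     convex_on UNIV (\<lambda>t. \<omega> (exp t)) \<and>
     (\<forall>t\<in>{0..1}. \<omega> t = 0)"

definition young_conj :: "(real \<Rightarrow> real) \<Rightarrow> real \<Rightarrow> ereal" where
  "young_conj \<omega> s = (SUP t\<in>{0..}. ereal (s * t - \<omega> (exp t)))"

definition exp_ereal :: "ereal \<Rightarrow> ereal" where
  "exp_ereal x = (if x = \<infinity> then \<infinity> else if x = - \<infinity> then 0 else ereal (exp (real_of_ereal x)))"


section \<open>Smooth functions\<close>

definition partial_deriv :: "'n::finite \<Rightarrow> (real ^ 'n \<Rightarrow> complex) \<Rightarrow> real ^ 'n \<Rightarrow> complex" where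
  "partial_deriv i f = (\<lambda>x. frechet_derivative f (at x) (axis i 1))"

primrec C_k :: "nat \<Rightarrow> (real ^ 'n::finite \<Rightarrow> complex) \<Rightarrow> bool" where
  "C_k 0 f \<longleftrightarrow> continuous_on UNIV f"
| "C_k (Suc k) f \<longleftrightarrow> (\<forall>x. f differentiable (at x)) \<and> (\<forall>i. C_k k (partial_deriv i f))"

definition smooth :: "(real ^ 'n::finite \<Rightarrow> complex) \<Rightarrow> bool" where
  "smooth f \<longleftrightarrow> (\<forall>k. C_k k f)"

(* The index type carries no order, so the order in which the partial derivatives are
   taken is fixed by an arbitrary enumeration; it is irrelevant for smooth functions. *)
definition coords :: "'n::finite list" where
  "coords = (SOME is. distinct is \<and> set is = UNIV)"

lemma coords: "distinct (coords :: 'n::finite list)" "set (coords :: 'n::finite list) = UNIV"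
proof -
  have "\<exists>is :: 'n list. distinct is \<and> set is = UNIV"
    using finite_distinct_list [of "UNIV :: 'n set"] by auto
  from someI_ex [OF this]
  show "distinct (coords :: 'n list)" "set (coords :: 'n list) = UNIV"
    by (simp_all add: coords_def)
qed

definition multi_deriv :: "('n::finite \<Rightarrow> nat) \<Rightarrow> (real ^ 'n \<Rightarrow> complex) \<Rightarrow> real ^ 'n \<Rightarrow> complex" where
  "multi_deriv \<alpha> f = foldr (\<lambda>i. partial_deriv i ^^ \<alpha> i) coords f"

definition multi_order :: "('n::finite \<Rightarrow> nat) \<Rightarrow> nat" where
  "multi_order \<alpha> = (\<Sum>i\<in>UNIV. \<alpha> i)"


section \<open>Locally convex topologies on spaces of functions\<close>

(* Vector spaces are carried by sets of complex-valued functions, with pointwise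
   operations. They are used both for spaces of functions on \<real>^n and for their duals. *)

definition fun_subspace :: "('a \<Rightarrow> complex) set \<Rightarrow> bool" where
  "fun_subspace V \<longleftrightarrow> 0 \<in> V \<and> (\<forall>f\<in>V. \<forall>g\<in>V. f + g \<in> V) \<and> (\<forall>c. \<forall>f\<in>V. (\<lambda>x. c * f x) \<in> V)"

definition seminorm_on :: "('a \<Rightarrow> complex) set \<Rightarrow> (('a \<Rightarrow> complex) \<Rightarrow> real) \<Rightarrow> bool" where
  "seminorm_on V p \<longleftrightarrow> (\<forall>f\<in>V. \<forall>g\<in>V. p (f + g) \<le> p f + p g) \<and>
     (\<forall>c. \<forall>f\<in>V. p (\<lambda>x. c * f x) = norm c * p f)"

definition seminorm_topology ::
  "('a \<Rightarrow> complex) set \<Rightarrow> (('a \<Rightarrow> complex) \<Rightarrow> real) set \<Rightarrow> ('a \<Rightarrow> complex) topology" where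
  "seminorm_topology V P = topology (\<lambda>U. U \<subseteq> V \<and>
     (\<forall>f\<in>U. \<exists>F \<epsilon>. finite F \<and> F \<subseteq> P \<and> \<epsilon> > 0 \<and> {g \<in> V. \<forall>p\<in>F. p (g - f) < \<epsilon>} \<subseteq> U))"

lemma openin_seminorm_topology:
  "openin (seminorm_topology V P) U \<longleftrightarrow> U \<subseteq> V \<and>
     (\<forall>f\<in>U. \<exists>F \<epsilon>. finite F \<and> F \<subseteq> P \<and> \<epsilon> > 0 \<and> {g \<in> V. \<forall>p\<in>F. p (g - f) < \<epsilon>} \<subseteq> U)"
proof -
  let ?N = "\<lambda>U f. \<exists>F \<epsilon>. finite F \<and> F \<subseteq> P \<and> \<epsilon> > 0 \<and> {g \<in> V. \<forall>p\<in>F. p (g - f) < \<epsilon>} \<subseteq> U"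
  have mono: "?N T f" if "?N S f" "S \<subseteq> T" for S T f
    using that by (meson order_trans)
  have inter: "?N (S \<inter> T) f" if S: "?N S f" and T: "?N T f" for S T f
  proof -
    obtain F d where F: "finite F" "F \<subseteq> P" "d > 0" "{g \<in> V. \<forall>p\<in>F. p (g - f) < d} \<subseteq> S"
      using S by blast
    obtain G e where G: "finite G" "G \<subseteq> P" "e > 0" "{g \<in> V. \<forall>p\<in>G. p (g - f) < e} \<subseteq> T"
      using T by blast
    have "{g \<in> V. \<forall>p\<in>F \<union> G. p (g - f) < min d e} \<subseteq> S \<inter> T"
      using F(4) G(4) by auto
    moreover have "finite (F \<union> G)" "F \<union> G \<subseteq> P" "min d e > 0"
      using F G by auto
    ultimately show ?thesis by blast
  qed
  have "istopology (\<lambda>U. U \<subseteq> V \<and> (\<forall>f\<in>U. ?N U f))"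
    unfolding istopology_def
  proof (intro conjI allI impI)
    fix S T assume ST: "S \<subseteq> V \<and> (\<forall>f\<in>S. ?N S f)" "T \<subseteq> V \<and> (\<forall>f\<in>T. ?N T f)"
    then show "S \<inter> T \<subseteq> V" by blast
    show "\<forall>f\<in>S \<inter> T. ?N (S \<inter> T) f"
    proof
      fix f assume "f \<in> S \<inter> T"
      then have "?N S f" "?N T f" using ST by simp_all
      then show "?N (S \<inter> T) f" by (rule inter)
    qed
  next
    fix \<K> assume K: "\<forall>S\<in>\<K>. S \<subseteq> V \<and> (\<forall>f\<in>S. ?N S f)"
    then show "\<Union>\<K> \<subseteq> V" by blast
    show "\<forall>f\<in>\<Union>\<K>. ?N (\<Union>\<K>) f"
    proof
      fix f assume "f \<in> \<Union>\<K>"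
      then obtain S where S: "S \<in> \<K>" "f \<in> S" by blast
      have "S \<subseteq> \<Union>\<K>" using S(1) by blast
      moreover have "?N S f" using K S by simp
      ultimately show "?N (\<Union>\<K>) f" by (rule mono [rotated])
    qed
  qed
  then show ?thesis
    by (simp add: seminorm_topology_def topology_inverse')
qed

lemma topspace_seminorm_topology [simp]: "topspace (seminorm_topology V P) = V"
proof
  show "topspace (seminorm_topology V P) \<subseteq> V"
    by (rule openin_seminorm_topology [THEN iffD1, OF openin_topspace, THEN conjunct1])
  have "openin (seminorm_topology V P) V"
    unfolding openin_seminorm_topology
  proof (intro conjI ballI)
    fix f
    have "finite {} \<and> {} \<subseteq> P \<and> (1::real) > 0 \<and> {g \<in> V. \<forall>p\<in>{}. p (g - f) < 1} \<subseteq> V"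
      by simp
    then show "\<exists>F \<epsilon>. finite F \<and> F \<subseteq> P \<and> \<epsilon> > 0 \<and> {g \<in> V. \<forall>p\<in>F. p (g - f) < \<epsilon>} \<subseteq> V"
      by (intro exI)
  qed simp
  then show "V \<subseteq> topspace (seminorm_topology V P)"
    by (rule openin_subset)
qed

(* The coarsest topology on the intersection that makes all inclusions continuous. *)
definition proj_lim :: "'i set \<Rightarrow> ('i \<Rightarrow> 'b topology) \<Rightarrow> 'b topology" where
  "proj_lim I X = topology_generated_by
     {U \<inter> (\<Inter>i\<in>I. topspace (X i)) | i U. i \<in> I \<and> openin (X i) U}"

lemma topspace_proj_lim:
  assumes "I \<noteq> {}"
  shows "topspace (proj_lim I X) = (\<Inter>i\<in>I. topspace (X i))"
proof -
  define V where "V = (\<Inter>i\<in>I. topspace (X i))"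
  obtain i where i: "i \<in> I" using assms by (meson equals0I)
  have sub: "V \<subseteq> topspace (X i)" unfolding V_def using i by (rule INF_lower)
  have "\<Union>{U \<inter> V | i U. i \<in> I \<and> openin (X i) U} = V"
  proof
    show "\<Union>{U \<inter> V | i U. i \<in> I \<and> openin (X i) U} \<subseteq> V" by auto
    show "V \<subseteq> \<Union>{U \<inter> V | i U. i \<in> I \<and> openin (X i) U}"
    proof
      fix x assume "x \<in> V"
      moreover from this have "x \<in> topspace (X i)" using sub by (rule rev_subsetD)
      ultimately have "x \<in> topspace (X i) \<inter> V" by simp
      moreover have "topspace (X i) \<inter> V \<in> {U \<inter> V | i U. i \<in> I \<and> openin (X i) U}"
        by (rule CollectI, intro exI conjI, rule refl, rule i, rule openin_topspace)
      ultimately show "x \<in> \<Union>{U \<inter> V | i U. i \<in> I \<and> openin (X i) U}" by (rule UnionI [rotated])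
    qed
  qed
  then show ?thesis
    by (simp only: proj_lim_def topology_generated_by_topspace V_def)
qed

(* The finest locally convex topology on the union that makes all inclusions continuous:
   it is given by all seminorms whose restriction to every step is continuous,
   see lc_ind_lim_continuous_inclusion and lc_ind_lim_finest. *)
definition lc_ind_lim ::
  "'i set \<Rightarrow> ('i \<Rightarrow> ('a \<Rightarrow> complex) topology) \<Rightarrow> ('a \<Rightarrow> complex) topology" where
  "lc_ind_lim I X = seminorm_topology (\<Union>i\<in>I. topspace (X i))
     {p. seminorm_on (\<Union>i\<in>I. topspace (X i)) p \<and> (\<forall>i\<in>I. continuous_map (X i) euclideanreal p)}"

lemma topspace_lc_ind_lim [simp]: "topspace (lc_ind_lim I X) = (\<Union>i\<in>I. topspace (X i))"
  by (simp add: lc_ind_lim_def)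

lemma lc_ind_lim_continuous_inclusion:
  assumes i: "i \<in> I"
    and transl: "\<And>f. f \<in> topspace (X i) \<Longrightarrow> continuous_map (X i) (X i) (\<lambda>g. g - f)"
  shows "continuous_map (X i) (lc_ind_lim I X) id"
  unfolding continuous_map_def
proof (intro conjI allI impI)
  show "id \<in> topspace (X i) \<rightarrow> topspace (lc_ind_lim I X)"
    using i by auto
  fix U assume U: "openin (lc_ind_lim I X) U"
  show "openin (X i) {x \<in> topspace (X i). id x \<in> U}"
  proof (subst openin_subopen, intro ballI)
    fix f assume "f \<in> {x \<in> topspace (X i). id x \<in> U}"
    then have f: "f \<in> topspace (X i)" "f \<in> U" by auto
    let ?V = "\<Union>i\<in>I. topspace (X i)"
    obtain F \<epsilon> where F: "finite F" "\<epsilon> > 0" "{g \<in> ?V. \<forall>p\<in>F. p (g - f) < \<epsilon>} \<subseteq> U"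
      and FP: "F \<subseteq> {p. seminorm_on ?V p \<and> (\<forall>i\<in>I. continuous_map (X i) euclideanreal p)}"
      using U f unfolding lc_ind_lim_def openin_seminorm_topology by meson
    let ?W = "{g \<in> topspace (X i). \<forall>p\<in>F. p (g - f) < \<epsilon>}"
    have "openin (X i) {g \<in> topspace (X i). p (g - f) \<in> {..<\<epsilon>}}" if "p \<in> F" for p
    proof (rule openin_continuous_map_preimage)
      show "continuous_map (X i) euclideanreal (\<lambda>g. p (g - f))"
        using continuous_map_compose [OF transl [OF f(1)], of euclideanreal p] FP that i
        by (auto simp: o_def)
    qed auto
    then have "openin (X i) (topspace (X i) \<inter> (\<Inter>p\<in>F. {g \<in> topspace (X i). p (g - f) < \<epsilon>}))"
      using openin_INT [OF F(1), of "X i"] by (simp add: Int_commute)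
    moreover have "topspace (X i) \<inter> (\<Inter>p\<in>F. {g \<in> topspace (X i). p (g - f) < \<epsilon>}) = ?W"
      by auto
    moreover have "p (f - f) < \<epsilon>" if "p \<in> F" for p
    proof -
      have "f \<in> ?V" using f i by blast
      then have "p (\<lambda>x. 0 * f x) = norm (0::complex) * p f"
        using FP that unfolding seminorm_on_def by blast
      moreover have "(\<lambda>x. 0 * f x) = f - f" by (auto simp: fun_eq_iff)
      ultimately show ?thesis using F(2) by simp
    qed
    ultimately have "openin (X i) ?W" "f \<in> ?W"
      using f by simp_all
    moreover have "?W \<subseteq> {x \<in> topspace (X i). id x \<in> U}"
      using F(3) i by auto
    ultimately show "\<exists>T. openin (X i) T \<and> f \<in> T \<and> T \<subseteq> {x \<in> topspace (X i). id x \<in> U}"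
      by meson
  qed
qed

lemma continuous_map_seminorm:
  assumes V: "fun_subspace V" and p: "seminorm_on V p" "p \<in> P"
  shows "continuous_map (seminorm_topology V P) euclideanreal p"
  unfolding continuous_map_def
proof (intro conjI allI impI)
  fix W assume "openin euclideanreal W"
  then have W: "open W" by simp
  have diff: "g - f \<in> V" if "g \<in> V" "f \<in> V" for f g
  proof -
    have "(\<lambda>x. (- 1) * f x) \<in> V" using V that unfolding fun_subspace_def by blast
    then have "g + (\<lambda>x. (- 1) * f x) \<in> V" using V that unfolding fun_subspace_def by blast
    moreover have "g + (\<lambda>x. (- 1) * f x) = g - f" by (auto simp: fun_eq_iff)
    ultimately show ?thesis by simp
  qed
  have sym: "p (f - g) = p (g - f)" if "g \<in> V" "f \<in> V" for f g
  proof -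
    have "p (\<lambda>x. (- 1) * (g - f) x) = norm (- 1 :: complex) * p (g - f)"
      using p(1) diff [OF that] unfolding seminorm_on_def by blast
    moreover have "(\<lambda>x. (- 1) * (g - f) x) = f - g" by (auto simp: fun_eq_iff)
    ultimately show ?thesis by simp
  qed
  have le: "p g \<le> p f + p (g - f)" if "g \<in> V" "f \<in> V" for f g
  proof -
    have "p (f + (g - f)) \<le> p f + p (g - f)"
      using p(1) that diff [OF that] unfolding seminorm_on_def by blast
    then show ?thesis by simp
  qed
  show "openin (seminorm_topology V P) {x \<in> topspace (seminorm_topology V P). p x \<in> W}"
    unfolding openin_seminorm_topology topspace_seminorm_topology
  proof (intro conjI ballI)
    fix f assume "f \<in> {x \<in> V. p x \<in> W}"
    then have f: "f \<in> V" "p f \<in> W" by auto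
    obtain e where e: "e > 0" "\<And>y. dist y (p f) < e \<Longrightarrow> y \<in> W"
      using W f(2) unfolding open_dist by blast
    have "p g \<in> W" if "g \<in> V" "p (g - f) < e" for g
      using le [of g f] le [of f g] sym [of g f] that f
      by (intro e(2)) (auto simp: dist_real_def)
    then have "{g \<in> V. \<forall>p\<in>{p}. p (g - f) < e} \<subseteq> {x \<in> V. p x \<in> W}" by auto
    then show "\<exists>F \<epsilon>. finite F \<and> F \<subseteq> P \<and> \<epsilon> > 0 \<and>
        {g \<in> V. \<forall>p\<in>F. p (g - f) < \<epsilon>} \<subseteq> {x \<in> V. p x \<in> W}"
      using e(1) p(2) by (intro exI [of _ "{p}"] exI [of _ e]) auto
  qed auto
qed auto

lemma lc_ind_lim_finest:
  assumes V: "V = (\<Union>i\<in>I. topspace (X i))" "fun_subspace V"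
    and Q: "\<And>q. q \<in> Q \<Longrightarrow> seminorm_on V q"
    and incl: "\<And>i. i \<in> I \<Longrightarrow> continuous_map (X i) (seminorm_topology V Q) id"
    and U: "openin (seminorm_topology V Q) U"
  shows "openin (lc_ind_lim I X) U"
proof -
  have "continuous_map (X i) euclideanreal q" if "i \<in> I" "q \<in> Q" for i q
    using continuous_map_compose [OF incl [OF that(1)] continuous_map_seminorm [OF V(2) Q that(2)]]
      that by simp
  then have "Q \<subseteq> {p. seminorm_on V p \<and> (\<forall>i\<in>I. continuous_map (X i) euclideanreal p)}"
    using Q by auto
  then show ?thesis
    using U unfolding lc_ind_lim_def openin_seminorm_topology V(1) [symmetric]
    by (meson order_trans)
qed

definition topological_dual ::
  "('a \<Rightarrow> complex) topology \<Rightarrow> (('a \<Rightarrow> complex) \<Rightarrow> complex) set" where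
  "topological_dual X = {T. (\<forall>f\<in>topspace X. \<forall>g\<in>topspace X. T (f + g) = T f + T g) \<and>
     (\<forall>c. \<forall>f\<in>topspace X. T (\<lambda>x. c * f x) = c * T f) \<and>
     continuous_map X euclidean T \<and>
     \<comment> \<open>functionals live on topspace X; outside they are normalized to zero\<close>
     (\<forall>f. f \<notin> topspace X \<longrightarrow> T f = 0)}"

definition bounded_in :: "('a \<Rightarrow> complex) topology \<Rightarrow> ('a \<Rightarrow> complex) set \<Rightarrow> bool" where
  "bounded_in X B \<longleftrightarrow> B \<subseteq> topspace X \<and>
     (\<forall>U. openin X U \<and> 0 \<in> U \<longrightarrow>
        (\<exists>s>0. \<forall>t\<ge>s. B \<subseteq> (\<lambda>f x. complex_of_real t * f x) ` U))"

(* B = {} is excluded because Sup {} is unspecified on the reals. *)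
definition strong_dual :: "('a \<Rightarrow> complex) topology \<Rightarrow> (('a \<Rightarrow> complex) \<Rightarrow> complex) topology" where
  "strong_dual X = seminorm_topology (topological_dual X)
     {\<lambda>T. SUP f\<in>B. norm (T f) | B. bounded_in X B \<and> B \<noteq> {}}"


section \<open>Spaces of ultradifferentiable functions\<close>

definition E_seminorm ::
  "(real \<Rightarrow> real) \<Rightarrow> (real ^ 'n) set \<Rightarrow> nat \<Rightarrow> (real ^ 'n::finite \<Rightarrow> complex) \<Rightarrow> ereal" where
  "E_seminorm \<omega> K m f = (SUP x\<in>K. SUP \<alpha>. ereal (norm (multi_deriv \<alpha> f x)) *
     exp_ereal (- (ereal (real m) * young_conj \<omega> (real (multi_order \<alpha>) / real m))))"

definition E_space :: "(real \<Rightarrow> real) \<Rightarrow> (real ^ 'n::finite \<Rightarrow> complex) set" where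
  "E_space \<omega> = {f. smooth f \<and> (\<forall>K m. compact K \<longrightarrow> 1 \<le> m \<longrightarrow> E_seminorm \<omega> K m f < \<infinity>)}"

definition O_norm ::
  "(real \<Rightarrow> real) \<Rightarrow> nat \<Rightarrow> nat \<Rightarrow> (real ^ 'n::finite \<Rightarrow> complex) \<Rightarrow> ereal" where
  "O_norm \<omega> m n f = (SUP \<alpha>. SUP x. ereal (norm (multi_deriv \<alpha> f x)) *
     exp_ereal (- ereal (real n * \<omega> (norm x))
       - ereal (real m) * young_conj \<omega> (real (multi_order \<alpha>) / real m)))"

definition O_step :: "(real \<Rightarrow> real) \<Rightarrow> nat \<Rightarrow> nat \<Rightarrow> (real ^ 'n::finite \<Rightarrow> complex) set" where
  "O_step \<omega> m n = {f. smooth f \<and> O_norm \<omega> m n f < \<infinity>}"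

definition O_step_top ::
  "(real \<Rightarrow> real) \<Rightarrow> nat \<Rightarrow> nat \<Rightarrow> (real ^ 'n::finite \<Rightarrow> complex) topology" where
  "O_step_top \<omega> m n = seminorm_topology (O_step \<omega> m n) {\<lambda>f. real_of_ereal (O_norm \<omega> m n f)}"

definition OM_space :: "(real \<Rightarrow> real) \<Rightarrow> (real ^ 'n::finite \<Rightarrow> complex) set" where
  "OM_space \<omega> = (\<Inter>m\<in>{1..}. \<Union>n\<in>{1..}. O_step \<omega> m n)"

definition OM_top :: "(real \<Rightarrow> real) \<Rightarrow> (real ^ 'n::finite \<Rightarrow> complex) topology" where
  "OM_top \<omega> = proj_lim {1..} (\<lambda>m. lc_ind_lim {1..} (\<lambda>n. O_step_top \<omega> m n))"

definition OC_space :: "(real \<Rightarrow> real) \<Rightarrow> (real ^ 'n::finite \<Rightarrow> complex) set" where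
  "OC_space \<omega> = (\<Union>n\<in>{1..}. \<Inter>m\<in>{1..}. O_step \<omega> m n)"

definition OC_top :: "(real \<Rightarrow> real) \<Rightarrow> (real ^ 'n::finite \<Rightarrow> complex) topology" where
  "OC_top \<omega> = lc_ind_lim {1..} (\<lambda>n. proj_lim {1..} (\<lambda>m. O_step_top \<omega> m n))"

lemma topspace_O_step_top [simp]: "topspace (O_step_top \<omega> m n) = O_step \<omega> m n"
  by (simp add: O_step_top_def)

lemma topspace_OM_top [simp]: "topspace (OM_top \<omega>) = OM_space \<omega>"
proof -
  have "{1..} \<noteq> ({} :: nat set)" by auto
  then show ?thesis by (simp add: OM_top_def OM_space_def topspace_proj_lim)
qed

lemma topspace_OC_top [simp]: "topspace (OC_top \<omega>) = OC_space \<omega>"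
proof -
  have "{1..} \<noteq> ({} :: nat set)" by auto
  then show ?thesis by (simp add: OC_top_def OC_space_def topspace_proj_lim)
qed


section \<open>Multipliers of strong duals\<close>

definition dual_mult ::
  "('a \<Rightarrow> complex) topology \<Rightarrow> ('a \<Rightarrow> complex) \<Rightarrow>
   (('a \<Rightarrow> complex) \<Rightarrow> complex) \<Rightarrow> ('a \<Rightarrow> complex) \<Rightarrow> complex" where
  "dual_mult X f T = (\<lambda>g. if g \<in> topspace X then T (f * g) else 0)"

definition dual_multiplier :: "('a \<Rightarrow> complex) topology \<Rightarrow> ('a \<Rightarrow> complex) \<Rightarrow> bool" where
  "dual_multiplier X f \<longleftrightarrow>
     (\<forall>T\<in>topological_dual X. (\<forall>g\<in>topspace X. f * g \<in> topspace X) \<and>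
        dual_mult X f T \<in> topological_dual X) \<and>
     continuous_map (strong_dual X) (strong_dual X) (dual_mult X f)"

(* Both requirements concern one f at a time, so the largest space whose elements satisfy
   them is the set of all \<omega>-ultradifferentiable f that do. *)
definition dual_multipliers ::
  "(real \<Rightarrow> real) \<Rightarrow> (real ^ 'n::finite \<Rightarrow> complex) topology \<Rightarrow> (real ^ 'n \<Rightarrow> complex) set" where
  "dual_multipliers \<omega> X = {f \<in> E_space \<omega>. dual_multiplier X f}"

end

theory Submission
  imports Defs
begin

text \<open>Both spaces contain the constant \<open>1\<close>, so a multiplier \<open>f = f \<sqdot> 1\<close> belongs to the space.
  Conversely, by the Leibniz rule and the doubling condition on \<open>\<omega>\<close>, multiplication by
  \<open>f \<in> O\<^sub>n\<^sup>m\<^sup>K\<close> is a bounded operator from \<open>O\<^sub>n\<^sub>'\<^sup>m\<^sup>K\<close> to the step with indices \<open>m\<close> and \<open>n' + n\<close>,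
  so it is continuous on \<open>O\<^sub>M\<close> and \<open>O\<^sub>C\<close>. Being continuous, it maps bounded sets to bounded sets,
  and hence its transpose is continuous for the strong topology.\<close>

section \<open>Continuity in locally convex topologies\<close>

text \<open>The product estimate does not keep the index \<open>m\<close>: a derivative of order k
  of a product has 2^k terms counted with repetition, and absorbing that factor costs the passage
  from \<open>m * K\<close> to \<open>m\<close>. The loss is harmless because both spaces contain a
  projective limit over \<open>m\<close>: continuity into it is tested for one \<open>m\<close> at a
  time, and the source supplies the index \<open>m * K\<close>. The growth index rises by the fixed
  amount \<open>n\<close>, which an inductive limit allows. The two spaces differ in the order of
  choice: for O_M the \<open>n\<close> belonging to \<open>f\<close> may depend on \<open>m\<close>,
  since the inductive limits are formed first, whereas for O_C one \<open>n\<close> has to serve all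
  \<open>m\<close>.

  The second obstacle is that the Young conjugate may be infinite. All estimates are therefore moved
  from \<open>ereal\<close> to a real infimum over a parameter t, and inequalities between weights
  become choices of a test point t.\<close>

lemma continuous_map_seminorm_topology:
  assumes M: "\<And>g. g \<in> V \<Longrightarrow> M g \<in> W"
    and bound: "\<And>q. q \<in> Q \<Longrightarrow> \<exists>p\<in>P. \<exists>C>0. \<forall>g\<in>V. \<forall>h\<in>V. q (M g - M h) \<le> C * p (g - h)"
  shows "continuous_map (seminorm_topology V P) (seminorm_topology W Q) M"
  unfolding continuous_map_def
proof (intro conjI allI impI)
  show "M \<in> topspace (seminorm_topology V P) \<rightarrow> topspace (seminorm_topology W Q)"
    using M by auto
  fix U assume U: "openin (seminorm_topology W Q) U"
  show "openin (seminorm_topology V P) {g \<in> topspace (seminorm_topology V P). M g \<in> U}"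
    unfolding openin_seminorm_topology topspace_seminorm_topology
  proof (intro conjI ballI)
    fix f assume "f \<in> {g \<in> V. M g \<in> U}"
    then have f: "f \<in> V" "M f \<in> U" by auto
    obtain F \<epsilon> where F: "finite F" "F \<subseteq> Q" "\<epsilon> > 0" "{g \<in> W. \<forall>q\<in>F. q (g - M f) < \<epsilon>} \<subseteq> U"
      using U f(2) unfolding openin_seminorm_topology by meson
    have "\<forall>q\<in>F. \<exists>p C. p \<in> P \<and> C > 0 \<and> (\<forall>g\<in>V. \<forall>h\<in>V. q (M g - M h) \<le> C * p (g - h))"
      using bound F(2) by (meson subsetD)
    then obtain p C where pC: "\<And>q. q \<in> F \<Longrightarrow> p q \<in> P" "\<And>q. q \<in> F \<Longrightarrow> C q > 0"
      "\<And>q g h. q \<in> F \<Longrightarrow> g \<in> V \<Longrightarrow> h \<in> V \<Longrightarrow> q (M g - M h) \<le> C q * p q (g - h)"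
      by metis
    \<comment> \<open>Inserting 1 keeps the maximum defined and positive when \<open>F\<close> is
      empty.\<close>
    define D where "D = Max (insert 1 (C ` F))"
    have D: "D > 0" "\<And>q. q \<in> F \<Longrightarrow> C q \<le> D"
      using F(1) by (auto simp: D_def less_le_trans [OF zero_less_one] intro!: Max_ge)
    have "M g \<in> U" if g: "g \<in> V" "\<forall>r\<in>p ` F. r (g - f) < \<epsilon> / D" for g
    proof -
      have "q (M g - M f) < \<epsilon>" if q: "q \<in> F" for q
      proof -
        have "q (M g - M f) \<le> C q * p q (g - f)" using pC q g f by blast
        also have "\<dots> < C q * (\<epsilon> / D)"
          using g(2) q pC(2) by (intro mult_strict_left_mono) auto
        also have "\<dots> \<le> D * (\<epsilon> / D)"
          using D q F(3) by (intro mult_right_mono) auto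
        also have "\<dots> = \<epsilon>" using D(1) by simp
        finally show ?thesis .
      qed
      then show ?thesis using F(4) M g(1) by auto
    qed
    then show "\<exists>F \<epsilon>. finite F \<and> F \<subseteq> P \<and> \<epsilon> > 0 \<and> {g \<in> V. \<forall>p\<in>F. p (g - f) < \<epsilon>} \<subseteq> {g \<in> V. M g \<in> U}"
      using F pC(1) D(1) by (intro exI [of _ "p ` F"] exI [of _ "\<epsilon> / D"]) auto
  qed auto
qed

lemma continuous_map_proj_lim_component:
  assumes "i \<in> I"
  shows "continuous_map (proj_lim I X) (X i) id"
  unfolding continuous_map_def
proof (intro conjI allI impI)
  have top: "topspace (proj_lim I X) = (\<Inter>i\<in>I. topspace (X i))"
    using assms by (intro topspace_proj_lim) auto
  show "id \<in> topspace (proj_lim I X) \<rightarrow> topspace (X i)"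
    using assms by (auto simp: top)
  fix U assume "openin (X i) U"
  then have "openin (proj_lim I X) (U \<inter> (\<Inter>i\<in>I. topspace (X i)))"
    unfolding proj_lim_def using assms by (intro topology_generated_by_Basis) blast
  then show "openin (proj_lim I X) {x \<in> topspace (proj_lim I X). id x \<in> U}"
    by (simp add: top Int_def conj_commute)
qed

lemma continuous_map_into_proj_lim:
  assumes "I \<noteq> {}" and M: "\<And>i. i \<in> I \<Longrightarrow> continuous_map Z (X i) M"
  shows "continuous_map Z (proj_lim I X) M"
  unfolding proj_lim_def
proof (rule continuous_on_generated_topo)
  have im: "M z \<in> topspace (X i)" if "z \<in> topspace Z" "i \<in> I" for z i
    using M [OF that(2)] that(1) by (auto simp: continuous_map_def)
  show "M ` topspace Z \<subseteq> \<Union>{U \<inter> (\<Inter>i\<in>I. topspace (X i)) | i U. i \<in> I \<and> openin (X i) U}"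
  proof clarify
    fix z assume "z \<in> topspace Z"
    moreover obtain i where "i \<in> I" using assms(1) by auto
    ultimately show "M z \<in> \<Union>{U \<inter> (\<Inter>i\<in>I. topspace (X i)) | i U. i \<in> I \<and> openin (X i) U}"
      using im by (intro UnionI [of "topspace (X i) \<inter> (\<Inter>i\<in>I. topspace (X i))"]) auto
  qed
  fix S assume "S \<in> {U \<inter> (\<Inter>i\<in>I. topspace (X i)) | i U. i \<in> I \<and> openin (X i) U}"
  then obtain i U where S: "S = U \<inter> (\<Inter>i\<in>I. topspace (X i))" "i \<in> I" "openin (X i) U"
    by auto
  have "M -` S \<inter> topspace Z = {z \<in> topspace Z. M z \<in> U}"
    using im by (auto simp: S(1))
  then show "openin Z (M -` S \<inter> topspace Z)"
    using M [OF S(2)] S(3) by (simp add: continuous_map_def)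
qed

lemma mult_scale_fun: "f * (\<lambda>x. c * g x) = (\<lambda>x. c * (f * g) x)" for c :: complex
  by (auto simp: fun_eq_iff)

lemma seminorm_on_mult:
  assumes q: "seminorm_on W q" and maps: "\<And>g. g \<in> V \<Longrightarrow> f * g \<in> W"
  shows "seminorm_on V (q \<circ> (*) f)"
  using q maps unfolding seminorm_on_def o_apply distrib_left mult_scale_fun by blast

text \<open>Seminorms are pulled back instead of open sets: if \<open>q\<close> is admissible for
  the target, then \<open>q\<close> after multiplication by \<open>f\<close> is continuous on every
  source step, being a composite through some \<open>Y j\<close>, and hence is one of the seminorms
  that define the source. By linearity the required bound is an equality with constant 1. The index
  j may depend on i, which leaves room for a growing step index.\<close>

lemma continuous_map_lc_ind_lim_mult:
  assumes steps: "\<And>i. i \<in> I \<Longrightarrow> \<exists>j\<in>J. continuous_map (X i) (Y j) ((*) f)"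
  shows "continuous_map (lc_ind_lim I X) (lc_ind_lim J Y) ((*) f)"
  unfolding lc_ind_lim_def
proof (rule continuous_map_seminorm_topology)
  let ?V = "\<Union>i\<in>I. topspace (X i)" and ?W = "\<Union>j\<in>J. topspace (Y j)"
  show maps: "f * g \<in> ?W" if g: "g \<in> ?V" for g
  proof -
    obtain i where i: "i \<in> I" "g \<in> topspace (X i)" using g by blast
    obtain j where "j \<in> J" "continuous_map (X i) (Y j) ((*) f)" using steps [OF i(1)] by blast
    then show ?thesis using continuous_map_image_subset_topspace i(2) by blast
  qed
  fix q assume "q \<in> {p. seminorm_on ?W p \<and> (\<forall>j\<in>J. continuous_map (Y j) euclideanreal p)}"
  then have q: "seminorm_on ?W q" "\<And>j. j \<in> J \<Longrightarrow> continuous_map (Y j) euclideanreal q"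
    by auto
  have "seminorm_on ?V (q \<circ> (*) f)"
    using q(1) maps by (rule seminorm_on_mult)
  moreover have "continuous_map (X i) euclideanreal (q \<circ> (*) f)" if i: "i \<in> I" for i
  proof -
    obtain j where "j \<in> J" "continuous_map (X i) (Y j) ((*) f)" using steps [OF i] by blast
    then show ?thesis using q(2) by (intro continuous_map_compose)
  qed
  ultimately show "\<exists>p\<in>{p. seminorm_on ?V p \<and> (\<forall>i\<in>I. continuous_map (X i) euclideanreal p)}.
      \<exists>C>0. \<forall>g\<in>?V. \<forall>h\<in>?V. q (f * g - f * h) \<le> C * p (g - h)"
    by (intro bexI [of _ "q \<circ> (*) f"] exI [of _ 1]) (auto simp: right_diff_distrib)
qed

section \<open>Transposed multiplication on strong duals\<close>

lemma bounded_in_continuous_mult: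
  assumes "continuous_map X X ((*) f)" "bounded_in X B"
  shows "bounded_in X ((*) f ` B)"
  unfolding bounded_in_def
proof (intro conjI allI impI)
  show "(*) f ` B \<subseteq> topspace X"
    using assms by (auto simp: bounded_in_def continuous_map_def)
  fix U assume U: "openin X U \<and> 0 \<in> U"
  have B: "B \<subseteq> topspace X" using assms(2) by (simp add: bounded_in_def)
  \<comment> \<open>This preimage of \<open>U\<close> is a neighbourhood of 0, so it absorbs
    \<open>B\<close>; multiplication by \<open>f\<close> commutes with the dilation by t and carries
    the absorption over to \<open>U\<close>.\<close>
  let ?U = "{g \<in> topspace X. f * g \<in> U}"
  show "\<exists>s>0. \<forall>t\<ge>s. (*) f ` B \<subseteq> (\<lambda>g x. complex_of_real t * g x) ` U"
  proof (cases "0 \<in> topspace X")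
    case True
    have "openin X ?U" using U assms(1) by (auto simp: continuous_map_def)
    moreover have "0 \<in> ?U" using U True by simp
    ultimately obtain s where s: "s > 0" "\<And>t. t \<ge> s \<Longrightarrow> B \<subseteq> (\<lambda>g x. complex_of_real t * g x) ` ?U"
      using assms(2) unfolding bounded_in_def by meson
    have "f * g \<in> (\<lambda>g x. complex_of_real t * g x) ` U" if t: "t \<ge> s" and g: "g \<in> B" for t g
    proof -
      obtain h where h: "h \<in> ?U" "g = (\<lambda>x. complex_of_real t * h x)" using s(2) [OF t] g by blast
      then have "f * g = (\<lambda>x. complex_of_real t * (f * h) x)" by (simp add: mult_scale_fun)
      then show ?thesis using h(1) by blast
    qed
    then show ?thesis using s(1) by blast
  next
    case False
    \<comment> \<open>An open set containing 0 cannot exist in this case.\<close>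
    then show ?thesis using U openin_subset by blast
  qed
qed

text \<open>The seminorm of \<open>B\<close> evaluated at f T is the seminorm of the bounded set f B
  evaluated at T, so the transpose is continuous with constant 1. The subspace hypothesis keeps sums
  and multiples inside \<open>topspace X\<close>; outside it \<open>dual_mult\<close> is cut off to
  0 and linearity could fail.\<close>

lemma dual_multiplier_if_continuous:
  assumes V: "fun_subspace (topspace X)" and f: "continuous_map X X ((*) f)"
  shows "dual_multiplier X f"
proof -
  have maps: "f * g \<in> topspace X" if "g \<in> topspace X" for g
    using f that by (auto simp: continuous_map_def)
  have dual: "dual_mult X f T \<in> topological_dual X" if T: "T \<in> topological_dual X" for T
  proof -
    have add: "T (f * (g + h)) = T (f * g) + T (f * h)" if "g \<in> topspace X" "h \<in> topspace X" for g h
      using T maps that by (simp add: topological_dual_def distrib_left)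
    have scale: "T (f * (\<lambda>x. c * g x)) = c * T (f * g)" if "g \<in> topspace X" for c g
      unfolding mult_scale_fun using T maps [OF that] unfolding topological_dual_def by blast
    have "continuous_map X euclidean (T \<circ> (*) f)"
      using T f by (intro continuous_map_compose [of X X]) (auto simp: topological_dual_def)
    then have "continuous_map X euclidean (dual_mult X f T)"
      by (rule continuous_map_eq) (simp add: dual_mult_def)
    then show ?thesis
      using V add scale unfolding topological_dual_def fun_subspace_def
      by (auto simp: dual_mult_def)
  qed
  have "continuous_map (strong_dual X) (strong_dual X) (dual_mult X f)"
    unfolding strong_dual_def
  proof (rule continuous_map_seminorm_topology [OF dual])
    fix q :: "(('a \<Rightarrow> complex) \<Rightarrow> complex) \<Rightarrow> real"
    assume "q \<in> {\<lambda>T. SUP g\<in>B. norm (T g) | B. bounded_in X B \<and> B \<noteq> {}}"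
    then obtain B where B: "q = (\<lambda>T. SUP g\<in>B. norm (T g))" "bounded_in X B" "B \<noteq> {}" by auto
    let ?p = "\<lambda>T :: ('a \<Rightarrow> complex) \<Rightarrow> complex. SUP g\<in>(*) f ` B. norm (T g)"
    have "?p \<in> {\<lambda>T. SUP g\<in>B. norm (T g) | B. bounded_in X B \<and> B \<noteq> {}}"
      using bounded_in_continuous_mult [OF f B(2)] B(3) by blast
    moreover have "q (dual_mult X f S - dual_mult X f T) = ?p (S - T)" for S T
    proof -
      have "B \<subseteq> topspace X" using B(2) by (simp add: bounded_in_def)
      then show ?thesis unfolding B(1) image_image
        by (intro SUP_cong) (auto simp: dual_mult_def)
    qed
    ultimately show "\<exists>p\<in>{\<lambda>T. SUP g\<in>B. norm (T g) | B. bounded_in X B \<and> B \<noteq> {}}.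
        \<exists>C>0. \<forall>S\<in>topological_dual X. \<forall>T\<in>topological_dual X.
          q (dual_mult X f S - dual_mult X f T) \<le> C * p (S - T)"
      by (intro bexI [of _ ?p] exI [of _ 1]) auto
  qed
  then show ?thesis
    using maps dual by (simp add: dual_multiplier_def)
qed

text \<open>In \<open>dual_multiplier\<close> the condition on the products f g stands under a
  quantifier over functionals T; the zero functional supplies an instance.\<close>

lemma in_topspace_if_dual_multiplier:
  assumes "dual_multiplier X f" "1 \<in> topspace X"
  shows "f \<in> topspace X"
proof -
  have "(\<lambda>_. 0) \<in> topological_dual X" by (simp add: topological_dual_def)
  then have "f * 1 \<in> topspace X"
    using assms unfolding dual_multiplier_def by blast
  then show ?thesis by simp
qed


section \<open>Smooth functions and the Leibniz rule\<close>

lemma partial_deriv_add: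
  assumes "\<And>x. f differentiable (at x)" "\<And>x. g differentiable (at x)"
  shows "partial_deriv i (f + g) = partial_deriv i f + partial_deriv i g"
proof
  fix x
  have "(f + g has_derivative (\<lambda>h. frechet_derivative f (at x) h + frechet_derivative g (at x) h)) (at x)"
    unfolding plus_fun_def
    by (intro has_derivative_add) (use assms frechet_derivative_works in blast)+
  then show "partial_deriv i (f + g) x = (partial_deriv i f + partial_deriv i g) x"
    using frechet_derivative_at [of "f + g" _ x] by (simp add: partial_deriv_def fun_eq_iff)
qed

lemma partial_deriv_mult:
  assumes "\<And>x. f differentiable (at x)" "\<And>x. g differentiable (at x)"
  shows "partial_deriv i (f * g) = partial_deriv i f * g + f * partial_deriv i g"
proof
  fix x
  have "(f * g has_derivative
      (\<lambda>h. f x * frechet_derivative g (at x) h + frechet_derivative f (at x) h * g x)) (at x)"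
    unfolding times_fun_def
    by (intro has_derivative_mult) (use assms frechet_derivative_works in blast)+
  then show "partial_deriv i (f * g) x = (partial_deriv i f * g + f * partial_deriv i g) x"
    using frechet_derivative_at [of "f * g" _ x] by (simp add: partial_deriv_def fun_eq_iff)
qed

lemma partial_deriv_const: "partial_deriv i (\<lambda>_. c) = (\<lambda>_. 0)"
  by (simp add: partial_deriv_def)

lemma C_k_const: "C_k k (\<lambda>_. c)"
  by (induction k arbitrary: c) (auto simp: partial_deriv_const)

text \<open>The product rule leaves one factor undifferentiated, and the induction for products
  needs that factor at the lower level k.\<close>

lemma C_k_SucD: "C_k (Suc k) f \<Longrightarrow> C_k k f"
proof (induction k arbitrary: f)
  case 0
  then show ?case
    by (auto intro!: differentiable_imp_continuous_on simp: differentiable_on_def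
      intro: differentiable_at_withinI)
next
  case (Suc k)
  then show ?case using C_k.simps(2) by blast
qed

lemma C_k_add: "C_k k f \<Longrightarrow> C_k k g \<Longrightarrow> C_k k (f + g)"
proof (induction k arbitrary: f g)
  case 0
  then show ?case by (auto simp: plus_fun_def intro: continuous_on_add)
next
  case (Suc k)
  then have d: "f differentiable (at x)" "g differentiable (at x)" for x by simp_all
  have "partial_deriv i (f + g) = partial_deriv i f + partial_deriv i g" for i
    using d by (rule partial_deriv_add)
  moreover have "C_k k (partial_deriv i f + partial_deriv i g)" for i
    using Suc.prems by (intro Suc.IH) simp_all
  moreover have "f + g differentiable (at x)" for x
    unfolding plus_fun_def using d by (rule differentiable_add)
  ultimately show ?case by (simp only: C_k.simps) blast
qed

lemma C_k_mult: "C_k k f \<Longrightarrow> C_k k g \<Longrightarrow> C_k k (f * g)"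
proof (induction k arbitrary: f g)
  case 0
  then show ?case by (auto simp: times_fun_def intro: continuous_on_mult)
next
  case (Suc k)
  then have d: "f differentiable (at x)" "g differentiable (at x)" for x by simp_all
  have "partial_deriv i (f * g) = partial_deriv i f * g + f * partial_deriv i g" for i
    using d by (rule partial_deriv_mult)
  moreover have "C_k k (partial_deriv i f * g + f * partial_deriv i g)" for i
    using Suc.prems C_k_SucD by (intro C_k_add Suc.IH) auto
  moreover have "f * g differentiable (at x)" for x
    unfolding times_fun_def using d by (rule differentiable_mult)
  ultimately show ?case by (simp only: C_k.simps) blast
qed

lemma smooth_const: "smooth (\<lambda>_. c)"
  by (simp add: smooth_def C_k_const)

lemma smooth_add: "smooth f \<Longrightarrow> smooth g \<Longrightarrow> smooth (f + g)"
  by (simp add: smooth_def C_k_add)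

lemma smooth_mult: "smooth f \<Longrightarrow> smooth g \<Longrightarrow> smooth (f * g)"
  by (simp add: smooth_def C_k_mult)

lemma smooth_differentiable: "smooth f \<Longrightarrow> f differentiable (at x)"
  unfolding smooth_def using C_k.simps(2) [of 0 f] by blast

lemma smooth_partial_deriv: "smooth f \<Longrightarrow> smooth (partial_deriv i f)"
  unfolding smooth_def using C_k.simps(2) by blast

lemma smooth_partial_deriv_funpow: "smooth f \<Longrightarrow> smooth ((partial_deriv i ^^ n) f)"
  by (induction n) (auto simp: smooth_partial_deriv)

lemma smooth_foldr: "smooth f \<Longrightarrow> smooth (foldr (\<lambda>i. partial_deriv i ^^ \<alpha> i) xs f)"
  by (induction xs) (auto simp: smooth_partial_deriv_funpow)

lemma smooth_sum_list: "(\<And>h. h \<in> set hs \<Longrightarrow> smooth h) \<Longrightarrow> smooth (sum_list hs)"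
proof (induction hs)
  case Nil
  show ?case using smooth_const [of 0] by (simp add: zero_fun_def)
qed (simp add: smooth_add)

lemma partial_deriv_sum_list:
  "(\<And>h. h \<in> set hs \<Longrightarrow> smooth h) \<Longrightarrow> partial_deriv i (sum_list hs) = sum_list (map (partial_deriv i) hs)"
proof (induction hs)
  case Nil
  show ?case using partial_deriv_const [of i 0] by (simp add: zero_fun_def)
qed (simp add: partial_deriv_add smooth_differentiable smooth_sum_list)

section \<open>Multi-index derivatives of sums, constants and products\<close>

lemma multi_deriv_add:
  assumes "smooth f" "smooth g"
  shows "multi_deriv \<alpha> (f + g) = multi_deriv \<alpha> f + multi_deriv \<alpha> g"
proof -
  have pow: "(partial_deriv i ^^ n) (f + g) = (partial_deriv i ^^ n) f + (partial_deriv i ^^ n) g"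
    if "smooth f" "smooth g" for i n and f g :: "real ^ 'a \<Rightarrow> complex"
    using that
    by (induction n) (simp_all add: partial_deriv_add smooth_differentiable smooth_partial_deriv_funpow)
  have "foldr (\<lambda>i. partial_deriv i ^^ \<alpha> i) xs (f + g) =
      foldr (\<lambda>i. partial_deriv i ^^ \<alpha> i) xs f + foldr (\<lambda>i. partial_deriv i ^^ \<alpha> i) xs g" for xs
    by (induction xs) (simp_all only: foldr.simps id_apply o_apply pow smooth_foldr assms)
  then show ?thesis by (simp add: multi_deriv_def)
qed

text \<open>Order zero returns c and every higher order gives 0; the bound on d covers both, so
  later estimates need no case distinction on \<open>\<alpha>\<close>.\<close>

lemma multi_deriv_const:
  fixes \<alpha> :: "'n::finite \<Rightarrow> nat"
  shows "\<exists>d. multi_deriv \<alpha> (\<lambda>_. c) = (\<lambda>_. d) \<and> norm d \<le> norm c"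
proof -
  have pow: "\<exists>d. (partial_deriv i ^^ n) (\<lambda>_. c) = (\<lambda>_. d) \<and> norm d \<le> norm c"
    for i :: 'n and n c
    by (induction n) (auto simp: partial_deriv_const)
  have "\<exists>d. foldr (\<lambda>i. partial_deriv i ^^ \<alpha> i) xs (\<lambda>_. c) = (\<lambda>_. d) \<and> norm d \<le> norm c"
    for xs :: "'n list"
  proof (induction xs)
    case (Cons i xs)
    then obtain d where d: "foldr (\<lambda>i. partial_deriv i ^^ \<alpha> i) xs (\<lambda>_. c) = (\<lambda>_. d)" "norm d \<le> norm c"
      by blast
    then show ?case using pow [where i = i and n = "\<alpha> i" and c = d] by (auto intro: order_trans)
  qed auto
  then show ?thesis by (simp add: multi_deriv_def)
qed

lemma multi_deriv_scale:
  assumes "smooth f"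
  shows "multi_deriv \<alpha> (\<lambda>x. c * f x) = (\<lambda>x. c * multi_deriv \<alpha> f x)"
proof -
  have step: "partial_deriv i (\<lambda>x. c * f x) = (\<lambda>x. c * partial_deriv i f x)" if "smooth f" for i f
    using partial_deriv_mult [of "\<lambda>_. c" f i] smooth_differentiable [OF that]
    by (simp add: times_fun_def plus_fun_def partial_deriv_const)
  have pow: "(partial_deriv i ^^ n) (\<lambda>x. c * f x) = (\<lambda>x. c * (partial_deriv i ^^ n) f x)"
    if "smooth f" for i n f
    using that by (induction n) (simp_all add: step smooth_partial_deriv_funpow)
  have "foldr (\<lambda>i. partial_deriv i ^^ \<alpha> i) xs (\<lambda>x. c * f x) =
      (\<lambda>x. c * foldr (\<lambda>i. partial_deriv i ^^ \<alpha> i) xs f x)" for xs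
    by (induction xs) (simp_all add: pow smooth_foldr assms)
  then show ?thesis by (simp add: multi_deriv_def)
qed

text \<open>Instead of binomial coefficients the terms are listed with repetition, so that one further
  derivative simply doubles the list.\<close>

lemma leibniz_foldr:
  assumes f: "smooth f" and g: "smooth g"
  shows "distinct xs \<Longrightarrow> \<exists>L. length L = 2 ^ (\<Sum>i\<in>set xs. \<alpha> i) \<and>
     (\<forall>(\<beta>, \<gamma>)\<in>set L. \<forall>i\<in>set xs. \<beta> i + \<gamma> i = \<alpha> i) \<and>
     foldr (\<lambda>i. partial_deriv i ^^ \<alpha> i) xs (f * g) =
       sum_list (map (\<lambda>(\<beta>, \<gamma>). foldr (\<lambda>i. partial_deriv i ^^ \<beta> i) xs f *
         foldr (\<lambda>i. partial_deriv i ^^ \<gamma> i) xs g) L)"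
proof (induction xs)
  case Nil
  \<comment> \<open>Only the length 1 = 2^0 matters: with no coordinates to constrain, any pair of
    exponents will do.\<close>
  show ?case by (intro exI [of _ "[(\<alpha>, \<alpha>)]"]) auto
next
  case (Cons i xs)
  let ?D = "\<lambda>\<beta> f. foldr (\<lambda>i. partial_deriv i ^^ \<beta> i) xs f"
  let ?E = "\<lambda>\<beta> f. (partial_deriv i ^^ \<beta> i) (?D \<beta> f)"
  have i: "i \<notin> set xs" using Cons.prems by simp
  have D_upd: "?D (\<beta>(i := k)) h = ?D \<beta> h" for \<beta> k h
    using i by (intro foldr_cong) auto
  have smE: "smooth (?E \<beta> h)" if "smooth h" for \<beta> h
    using that by (intro smooth_partial_deriv_funpow smooth_foldr)
  \<comment> \<open>Inner induction on the number n of derivatives in direction i. Since i does not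
    occur in \<open>xs\<close>, the entries at i serve as free counters that do not affect
    \<open>?D\<close>.\<close>
  have "\<exists>L. length L = 2 ^ (n + (\<Sum>j\<in>set xs. \<alpha> j)) \<and>
      (\<forall>(\<beta>, \<gamma>)\<in>set L. \<beta> i + \<gamma> i = n \<and> (\<forall>j\<in>set xs. \<beta> j + \<gamma> j = \<alpha> j)) \<and>
      (partial_deriv i ^^ n) (?D \<alpha> (f * g)) = sum_list (map (\<lambda>(\<beta>, \<gamma>). ?E \<beta> f * ?E \<gamma> g) L)" for n
  proof (induction n)
    case 0
    obtain L where L: "length L = 2 ^ (\<Sum>i\<in>set xs. \<alpha> i)"
      "\<forall>(\<beta>, \<gamma>)\<in>set L. \<forall>i\<in>set xs. \<beta> i + \<gamma> i = \<alpha> i"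
      "?D \<alpha> (f * g) = sum_list (map (\<lambda>(\<beta>, \<gamma>). ?D \<beta> f * ?D \<gamma> g) L)"
      using Cons.IH Cons.prems unfolding distinct.simps by blast
    \<comment> \<open>The outer hypothesis says nothing about the entries at i, so both counters are
      reset to 0.\<close>
    let ?L = "map (\<lambda>(\<beta>, \<gamma>). (\<beta>(i := 0), \<gamma>(i := 0))) L"
    have "map (\<lambda>(\<beta>, \<gamma>). ?E \<beta> f * ?E \<gamma> g) ?L = map (\<lambda>(\<beta>, \<gamma>). ?D \<beta> f * ?D \<gamma> g) L"
      by (auto simp: D_upd fun_upd_same simp del: fun_upd_apply)
    then have "(partial_deriv i ^^ 0) (?D \<alpha> (f * g)) = sum_list (map (\<lambda>(\<beta>, \<gamma>). ?E \<beta> f * ?E \<gamma> g) ?L)"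
      unfolding L(3) funpow_0 by (rule arg_cong [OF sym])
    moreover have "length ?L = 2 ^ (0 + (\<Sum>j\<in>set xs. \<alpha> j))" using L(1) by simp
    moreover have "\<forall>(\<beta>, \<gamma>)\<in>set ?L. \<beta> i + \<gamma> i = 0 \<and> (\<forall>j\<in>set xs. \<beta> j + \<gamma> j = \<alpha> j)"
      using L(2) i by fastforce
    ultimately show ?case by blast
  next
    case (Suc n)
    then obtain L where L: "length L = 2 ^ (n + (\<Sum>j\<in>set xs. \<alpha> j))"
      "\<forall>(\<beta>, \<gamma>)\<in>set L. \<beta> i + \<gamma> i = n \<and> (\<forall>j\<in>set xs. \<beta> j + \<gamma> j = \<alpha> j)"
      "(partial_deriv i ^^ n) (?D \<alpha> (f * g)) = sum_list (map (\<lambda>(\<beta>, \<gamma>). ?E \<beta> f * ?E \<gamma> g) L)"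
      by blast
    let ?L1 = "map (\<lambda>(\<beta>, \<gamma>). (\<beta>(i := Suc (\<beta> i)), \<gamma>)) L"
    let ?L2 = "map (\<lambda>(\<beta>, \<gamma>). (\<beta>, \<gamma>(i := Suc (\<gamma> i)))) L"
    have "(partial_deriv i ^^ Suc n) (?D \<alpha> (f * g)) =
        sum_list (map (partial_deriv i) (map (\<lambda>(\<beta>, \<gamma>). ?E \<beta> f * ?E \<gamma> g) L))"
      by (simp only: funpow.simps o_apply L(3), rule partial_deriv_sum_list)
        (auto intro!: smooth_mult smE f g)
    also have "\<dots> = (\<Sum>(\<beta>, \<gamma>)\<leftarrow>L. partial_deriv i (?E \<beta> f) * ?E \<gamma> g + ?E \<beta> f * partial_deriv i (?E \<gamma> g))"
      unfolding map_map
      by (intro arg_cong [where f = sum_list] map_cong refl)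
        (auto intro!: partial_deriv_mult smooth_differentiable smE f g)
    also have "\<dots> = sum_list (map (\<lambda>(\<beta>, \<gamma>). ?E \<beta> f * ?E \<gamma> g) (?L1 @ ?L2))"
      by (simp add: D_upd fun_upd_same o_def case_prod_unfold sum_list_addf del: fun_upd_apply)
    finally have "(partial_deriv i ^^ Suc n) (?D \<alpha> (f * g)) =
      sum_list (map (\<lambda>(\<beta>, \<gamma>). ?E \<beta> f * ?E \<gamma> g) (?L1 @ ?L2))" .
    moreover have "length (?L1 @ ?L2) = 2 ^ (Suc n + (\<Sum>j\<in>set xs. \<alpha> j))"
      using L(1) by simp
    moreover have "\<forall>(\<beta>, \<gamma>)\<in>set (?L1 @ ?L2). \<beta> i + \<gamma> i = Suc n \<and> (\<forall>j\<in>set xs. \<beta> j + \<gamma> j = \<alpha> j)"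
      using L(2) i by fastforce
    ultimately show ?case by blast
  qed
  from this [of "\<alpha> i"] show ?case
    using i by (simp only: foldr.simps o_apply list.set ball_simps sum.insert finite_set simp_thms)
qed

text \<open>The weights see a multi-index only through its order, so of the relation between
  \<open>\<beta>\<close>, \<open>\<gamma>\<close> and \<open>\<alpha>\<close> only the equality of
  orders is kept.\<close>

lemma leibniz:
  assumes "smooth f" "smooth g"
  obtains L where "length L = 2 ^ multi_order \<alpha>"
    "\<And>\<beta> \<gamma>. (\<beta>, \<gamma>) \<in> set L \<Longrightarrow> multi_order \<beta> + multi_order \<gamma> = multi_order \<alpha>"
    "multi_deriv \<alpha> (f * g) = (\<Sum>(\<beta>, \<gamma>)\<leftarrow>L. multi_deriv \<beta> f * multi_deriv \<gamma> g)"
proof -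
  obtain L where L: "length L = 2 ^ multi_order \<alpha>"
    "\<forall>(\<beta>, \<gamma>)\<in>set L. \<forall>i. \<beta> i + \<gamma> i = \<alpha> i"
    "multi_deriv \<alpha> (f * g) = (\<Sum>(\<beta>, \<gamma>)\<leftarrow>L. multi_deriv \<beta> f * multi_deriv \<gamma> g)"
    using leibniz_foldr [OF assms coords(1), of \<alpha>]
    unfolding multi_deriv_def multi_order_def coords(2) by auto
  have "multi_order \<beta> + multi_order \<gamma> = multi_order \<alpha>" if "(\<beta>, \<gamma>) \<in> set L" for \<beta> \<gamma>
    using L(2) that unfolding multi_order_def sum.distrib [symmetric] by (intro sum.cong) auto
  then show ?thesis using that L by blast
qed


section \<open>The weights\<close>

text \<open>The real number \<open>exp (- m \<phi>\<^sup>*(k/m))\<close>, which is \<open>0\<close> where the Young conjugate is infinite.\<close>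

definition conj_weight :: "(real \<Rightarrow> real) \<Rightarrow> nat \<Rightarrow> nat \<Rightarrow> real" where
  "conj_weight \<omega> m k = (INF t\<in>{0..}. exp (real m * \<omega> (exp t) - real k * t))"

lemma conj_weight_bdd_below: "bdd_below ((\<lambda>t. exp (real m * \<omega> (exp t) - real k * t)) ` {0..})"
  by (intro bdd_belowI [of _ 0]) auto

lemma conj_weight_le: "t \<ge> 0 \<Longrightarrow> conj_weight \<omega> m k \<le> exp (real m * \<omega> (exp t) - real k * t)"
  unfolding conj_weight_def by (intro cINF_lower conj_weight_bdd_below) auto

lemma conj_weight_ge:
  "(\<And>t. t \<ge> 0 \<Longrightarrow> c \<le> exp (real m * \<omega> (exp t) - real k * t)) \<Longrightarrow> c \<le> conj_weight \<omega> m k"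
  unfolding conj_weight_def by (intro cINF_greatest) auto

lemma conj_weight_nonneg: "0 \<le> conj_weight \<omega> m k"
  by (intro conj_weight_ge) simp

text \<open>Test point t = 0, where the normalization gives exp 0.\<close>

lemma conj_weight_le_1: "\<omega> 1 = 0 \<Longrightarrow> conj_weight \<omega> m k \<le> 1"
  using conj_weight_le [of 0 \<omega> m k] by simp

text \<open>Multiplying s t - \<open>\<omega> (exp t)\<close> by -m at s = k/m gives
  \<open>m * \<omega> (exp t) - k * t\<close>, so the supremum turns into an infimum. The summand c
  carries the growth weight in \<open>O_norm\<close> and is 0 for \<open>E_seminorm\<close>.\<close>

lemma exp_young_conj:
  assumes m: "m \<ge> 1"
  shows "exp_ereal (- ereal c - ereal (real m) * young_conj \<omega> (real k / real m)) =
    ereal (exp (- c) * conj_weight \<omega> m k)"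
proof -
  let ?y = "young_conj \<omega> (real k / real m)" and ?w = "conj_weight \<omega> m k"
  have y_ge: "ereal (real k / real m * t - \<omega> (exp t)) \<le> ?y" if "t \<ge> 0" for t
    unfolding young_conj_def using that by (intro SUP_upper) auto
  \<comment> \<open>A positive infimum bounds the conjugate from above; conversely an infinite
    conjugate forces the infimum to be 0, which settles the infinite case below.\<close>
  have y_le: "?y \<le> ereal (- ln ?w / real m)" if w: "?w > 0"
    unfolding young_conj_def
  proof (rule SUP_least)
    fix t :: real assume "t \<in> {0..}"
    then have "ln ?w \<le> real m * \<omega> (exp t) - real k * t"
      using conj_weight_le [of t \<omega> m k] w by (metis exp_gt_zero ln_exp ln_le_cancel_iff atLeast_iff)
    then have "(real k * t - real m * \<omega> (exp t)) / real m \<le> - ln ?w / real m"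
      by (intro divide_right_mono) auto
    moreover have "(real k * t - real m * \<omega> (exp t)) / real m = real k / real m * t - \<omega> (exp t)"
      using m by (simp add: diff_divide_distrib)
    ultimately have "real k / real m * t - \<omega> (exp t) \<le> - ln ?w / real m" by simp
    then show "ereal (real k / real m * t - \<omega> (exp t)) \<le> ereal (- ln ?w / real m)" by simp
  qed
  show ?thesis
  proof (cases ?y)
    case (real r)
    have "exp (- real m * r) \<le> ?w"
    proof (rule conj_weight_ge)
      fix t :: real assume "t \<ge> 0"
      then have "real k / real m * t - \<omega> (exp t) \<le> r" using y_ge [of t] real by simp
      then show "exp (- real m * r) \<le> exp (real m * \<omega> (exp t) - real k * t)"
        using m by (simp add: field_simps)
    qed
    moreover from this have w: "?w > 0" using less_le_trans [OF exp_gt_zero] by blast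
    moreover have "ln ?w \<le> - real m * r"
      using y_le [OF w] real m by (simp add: field_simps)
    ultimately have "?w = exp (- real m * r)"
      by (metis antisym exp_le_cancel_iff exp_ln)
    then show ?thesis by (simp add: real exp_ereal_def exp_add [symmetric])
  next
    case PInf
    then have "?w = 0" using y_le conj_weight_nonneg [of \<omega> m k] by force
    then show ?thesis using m PInf by (simp add: exp_ereal_def)
  next
    case MInf
    then show ?thesis using y_ge [of 0] by simp
  qed
qed

text \<open>For test points s and t of the two factors, the larger one u serves the left side:
  replacing the smaller point by u only lowers its linear part, and the surplus term m
  \<open>\<omega>\<close> of the smaller point is nonnegative.\<close>

lemma conj_weight_add_le:
  assumes "\<And>t. t \<ge> 0 \<Longrightarrow> \<omega> t \<ge> 0"
  shows "conj_weight \<omega> m (j + k) \<le> conj_weight \<omega> m j * conj_weight \<omega> m k"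
proof -
  have le: "conj_weight \<omega> m (j + k) \<le>
      exp (real m * \<omega> (exp s) - real j * s) * exp (real m * \<omega> (exp t) - real k * t)"
    if s: "s \<ge> 0" and t: "t \<ge> 0" for s t
  proof -
    have *: "0 \<le> real m * \<omega> (exp u)" for u using assms by simp
    define u where "u = max s t"
    have "real m * \<omega> (exp u) - real (j + k) * u \<le>
        (real m * \<omega> (exp s) - real j * s) + (real m * \<omega> (exp t) - real k * t)"
    proof (cases "s \<le> t")
      case True
      then have "real j * s \<le> real j * t" by (simp add: mult_left_mono)
      then show ?thesis using * [of s] True by (simp add: u_def algebra_simps)
    next
      case False
      then have "real k * t \<le> real k * s" by (simp add: mult_left_mono)
      then show ?thesis using * [of t] False by (simp add: u_def algebra_simps)
    qed
    moreover have "conj_weight \<omega> m (j + k) \<le> exp (real m * \<omega> (exp u) - real (j + k) * u)"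
      using s by (intro conj_weight_le) (simp add: u_def)
    ultimately show ?thesis
      by (simp only: exp_add [symmetric]) (meson exp_le_cancel_iff order_trans)
  qed
  \<comment> \<open>The infimum is taken in one variable at a time, dividing by the other factor.
    The second division is by an infimum that may vanish, hence the case distinction at the
    end.\<close>
  have "conj_weight \<omega> m (j + k) / exp (real m * \<omega> (exp s) - real j * s) \<le> conj_weight \<omega> m k"
    if "s \<ge> 0" for s
    using le [OF that] by (intro conj_weight_ge) (simp add: divide_le_eq mult.commute)
  then have le': "conj_weight \<omega> m (j + k) \<le> conj_weight \<omega> m k * exp (real m * \<omega> (exp s) - real j * s)"
    if "s \<ge> 0" for s
    using that by (simp add: divide_le_eq)
  show ?thesis
  proof (cases "conj_weight \<omega> m k > 0")
    case True
    then have "conj_weight \<omega> m (j + k) / conj_weight \<omega> m k \<le> conj_weight \<omega> m j"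
      using le' by (intro conj_weight_ge) (simp add: divide_le_eq mult.commute)
    then show ?thesis using True by (simp add: divide_le_eq)
  next
    case False
    then have "conj_weight \<omega> m k = 0" using conj_weight_nonneg [of \<omega> m k] by simp
    then show ?thesis using le' [of 0] by simp
  qed
qed

text \<open>Shifting the variable of the Young conjugate by \<open>ln 2\<close> turns the doubling condition on
  \<open>\<omega>\<close> into a bound that absorbs the number of terms in the Leibniz rule.\<close>

lemma conj_weight_doubling:
  assumes K: "\<And>t. t \<ge> 0 \<Longrightarrow> \<omega> (2 * t) \<le> real K * (1 + \<omega> t)"
  shows "2 ^ k * conj_weight \<omega> m k \<le> exp (real (m * K)) * conj_weight \<omega> (m * K) k"
proof -
  have "2 ^ k * conj_weight \<omega> m k / exp (real (m * K)) \<le> conj_weight \<omega> (m * K) k"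
  proof (rule conj_weight_ge)
    fix t :: real assume t: "t \<ge> 0"
    have pow: "(2::real) ^ k = exp (real k * ln 2)" by (simp add: exp_of_nat_mult)
    have "conj_weight \<omega> m k \<le> exp (real m * \<omega> (exp (t + ln 2)) - real k * (t + ln 2))"
      using t by (intro conj_weight_le) simp
    then have "2 ^ k * conj_weight \<omega> m k \<le>
        2 ^ k * exp (real m * \<omega> (exp (t + ln 2)) - real k * (t + ln 2))"
      by (intro mult_left_mono) auto
    also have "\<dots> = exp (real m * \<omega> (2 * exp t) - real k * t)"
      unfolding pow exp_add [symmetric] by (simp add: exp_add algebra_simps)
    \<comment> \<open>The summand 1 in K (1 + \<open>\<omega>\<close>) produces the constant exp (m
      K), the summand \<open>\<omega>\<close> the new index m K.\<close>
    also have "\<dots> \<le> exp (real (m * K) + (real (m * K) * \<omega> (exp t) - real k * t))"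
      using mult_left_mono [OF K [of "exp t"], of "real m"] by (simp add: algebra_simps)
    finally show "2 ^ k * conj_weight \<omega> m k / exp (real (m * K)) \<le>
        exp (real (m * K) * \<omega> (exp t) - real k * t)"
      by (simp add: exp_add divide_le_eq mult.commute)
  qed
  then show ?thesis by (simp add: divide_le_eq mult.commute)
qed


section \<open>The spaces of ultradifferentiable functions\<close>

text \<open>An explicit real constant in place of an extended supremum lets the Leibniz estimate be
  carried out in the reals.\<close>

definition O_bound ::
  "(real \<Rightarrow> real) \<Rightarrow> nat \<Rightarrow> nat \<Rightarrow> real \<Rightarrow> (real ^ 'n::finite \<Rightarrow> complex) \<Rightarrow> bool" where
  "O_bound \<omega> m n C f \<longleftrightarrow> (\<forall>\<alpha> x.
     norm (multi_deriv \<alpha> f x) * (exp (- (real n * \<omega> (norm x))) * conj_weight \<omega> m (multi_order \<alpha>)) \<le> C)"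

lemma O_norm_le_iff:
  assumes "m \<ge> 1"
  shows "O_norm \<omega> m n f \<le> ereal C \<longleftrightarrow> O_bound \<omega> m n C f"
  unfolding O_norm_def O_bound_def exp_young_conj [OF assms] by (simp add: SUP_le_iff)

lemma O_norm_nonneg:
  assumes "m \<ge> 1"
  shows "0 \<le> O_norm \<omega> m n f"
  unfolding O_norm_def exp_young_conj [OF assms]
  by (intro SUP_upper2 UNIV_I) (simp add: conj_weight_nonneg)

lemma O_bound_nonneg:
  assumes "O_bound \<omega> m n C f"
  shows "0 \<le> C"
proof -
  have "0 \<le> norm (multi_deriv (\<lambda>_. 0) f 0) *
      (exp (- (real n * \<omega> (norm (0 :: real ^ 'a)))) * conj_weight \<omega> m (multi_order (\<lambda>_::'a. 0)))"
    by (simp add: conj_weight_nonneg)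
  also have "\<dots> \<le> C" using assms unfolding O_bound_def by blast
  finally show ?thesis .
qed

lemma O_step_iff:
  assumes "m \<ge> 1"
  shows "f \<in> O_step \<omega> m n \<longleftrightarrow> smooth f \<and> (\<exists>C. O_bound \<omega> m n C f)"
  using O_norm_nonneg [OF assms, of \<omega> n f]
  by (cases "O_norm \<omega> m n f") (auto simp: O_step_def O_norm_le_iff [OF assms, symmetric])

text \<open>Together with \<open>O_norm_le_real\<close> this makes the norm the least admissible
  constant. Membership in the step excludes the value infinity, which \<open>real_of_ereal\<close>
  would send to 0.\<close>

lemma O_bound_O_norm:
  assumes "m \<ge> 1" "f \<in> O_step \<omega> m n"
  shows "O_bound \<omega> m n (real_of_ereal (O_norm \<omega> m n f)) f"
  using O_norm_nonneg [OF assms(1), of \<omega> n f] assms(2)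
  by (cases "O_norm \<omega> m n f") (auto simp: O_step_def O_norm_le_iff [OF assms(1), symmetric])

lemma O_norm_le_real:
  assumes "m \<ge> 1" "O_bound \<omega> m n C f"
  shows "real_of_ereal (O_norm \<omega> m n f) \<le> C"
  using O_norm_nonneg [OF assms(1), of \<omega> n f] assms(2)
  by (cases "O_norm \<omega> m n f") (auto simp: O_norm_le_iff [OF assms(1), symmetric])

lemma O_bound_add:
  fixes f g :: "real ^ 'n::finite \<Rightarrow> complex"
  assumes "smooth f" "smooth g" "O_bound \<omega> m n C f" "O_bound \<omega> m n D g"
  shows "O_bound \<omega> m n (C + D) (f + g)"
  unfolding O_bound_def
proof (intro allI)
  fix \<alpha> :: "'n \<Rightarrow> nat" and x :: "real ^ 'n"
  let ?w = "exp (- (real n * \<omega> (norm x))) * conj_weight \<omega> m (multi_order \<alpha>)"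
  have "norm (multi_deriv \<alpha> (f + g) x) * ?w \<le> (norm (multi_deriv \<alpha> f x) + norm (multi_deriv \<alpha> g x)) * ?w"
    by (intro mult_right_mono) (auto simp: multi_deriv_add assms conj_weight_nonneg norm_triangle_ineq)
  also have "\<dots> \<le> C + D"
    using assms(3,4) unfolding O_bound_def distrib_right by (intro add_mono) auto
  finally show "norm (multi_deriv \<alpha> (f + g) x) * ?w \<le> C + D" .
qed

lemma O_bound_const:
  assumes "\<omega> 1 = 0" "\<And>t. t \<ge> 0 \<Longrightarrow> \<omega> t \<ge> 0"
  shows "O_bound \<omega> m n (norm c) (\<lambda>_ :: real ^ 'n::finite. c)"
  unfolding O_bound_def
proof (intro allI)
  fix \<alpha> :: "'n \<Rightarrow> nat" and x :: "real ^ 'n"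
  obtain d where d: "multi_deriv \<alpha> (\<lambda>_. c) = (\<lambda>_. d)" and d_le: "norm d \<le> norm c"
    using multi_deriv_const by blast
  have "exp (- (real n * \<omega> (norm x))) * conj_weight \<omega> m (multi_order \<alpha>) \<le> 1"
    using assms by (intro mult_le_one conj_weight_nonneg conj_weight_le_1) auto
  then show "norm (multi_deriv \<alpha> (\<lambda>_. c) x) *
      (exp (- (real n * \<omega> (norm x))) * conj_weight \<omega> m (multi_order \<alpha>)) \<le> norm c"
    unfolding d using d_le by (meson mult_left_le norm_ge_zero order_trans)
qed

text \<open>With the weight of index \<open>m * K\<close>, every Leibniz term is at most
  \<open>C * D\<close>: the growth factor splits exactly, the conjugate weight submultiplicatively.
  The 2^k terms are then paid for by lowering the index to m through
  \<open>conj_weight_doubling\<close>.\<close>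

lemma O_bound_mult:
  fixes f g :: "real ^ 'n::finite \<Rightarrow> complex"
  assumes f: "smooth f" "O_bound \<omega> (m * K) n C f" and g: "smooth g" "O_bound \<omega> (m * K) n' D g"
    and K: "\<And>t. t \<ge> 0 \<Longrightarrow> \<omega> (2 * t) \<le> real K * (1 + \<omega> t)" and pos: "\<And>t. t \<ge> 0 \<Longrightarrow> \<omega> t \<ge> 0"
  shows "O_bound \<omega> m (n' + n) (exp (real (m * K)) * C * D) (f * g)"
  unfolding O_bound_def
proof (intro allI)
  fix \<alpha> :: "'n \<Rightarrow> nat" and x :: "real ^ 'n"
  let ?W = "conj_weight \<omega> (m * K)" and ?k = "multi_order \<alpha>"
  define e where "e n = exp (- (real n * \<omega> (norm x)))" for n
  have e: "e (n' + n) = e n * e n'" by (simp add: e_def algebra_simps flip: exp_add)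
  obtain L where L: "length L = 2 ^ ?k"
    "\<And>\<beta> \<gamma>. (\<beta>, \<gamma>) \<in> set L \<Longrightarrow> multi_order \<beta> + multi_order \<gamma> = ?k"
    "multi_deriv \<alpha> (f * g) = (\<Sum>(\<beta>, \<gamma>)\<leftarrow>L. multi_deriv \<beta> f * multi_deriv \<gamma> g)"
    using leibniz [OF f(1) g(1), of \<alpha>] by blast
  have sum_apply: "(sum_list hs) x = (\<Sum>h\<leftarrow>hs. h x)" for hs :: "(real ^ 'n \<Rightarrow> complex) list"
    by (induction hs) auto
  have summand: "norm (multi_deriv \<beta> f x * multi_deriv \<gamma> g x) * (e (n' + n) * ?W ?k) \<le> C * D"
    if bc: "(\<beta>, \<gamma>) \<in> set L" for \<beta> \<gamma>
  proof -
    have "?W ?k \<le> ?W (multi_order \<beta>) * ?W (multi_order \<gamma>)"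
      using conj_weight_add_le [where \<omega> = \<omega> and j = "multi_order \<beta>" and k = "multi_order \<gamma>", OF pos]
      by (simp add: L(2) [OF bc])
    then have "norm (multi_deriv \<beta> f x * multi_deriv \<gamma> g x) * (e (n' + n) * ?W ?k) \<le>
        norm (multi_deriv \<beta> f x * multi_deriv \<gamma> g x) *
        (e (n' + n) * (?W (multi_order \<beta>) * ?W (multi_order \<gamma>)))"
      by (intro mult_left_mono) (auto simp: e_def)
    also have "\<dots> = (norm (multi_deriv \<beta> f x) * (e n * ?W (multi_order \<beta>))) *
        (norm (multi_deriv \<gamma> g x) * (e n' * ?W (multi_order \<gamma>)))"
      by (simp add: e norm_mult mult_ac)
    also have "\<dots> \<le> C * D"
    proof (rule mult_mono)
      show "norm (multi_deriv \<beta> f x) * (e n * ?W (multi_order \<beta>)) \<le> C"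
        using f(2) unfolding O_bound_def e_def by blast
      show "norm (multi_deriv \<gamma> g x) * (e n' * ?W (multi_order \<gamma>)) \<le> D"
        using g(2) unfolding O_bound_def e_def by blast
    qed (auto simp: O_bound_nonneg [OF f(2)] conj_weight_nonneg e_def)
    finally show ?thesis .
  qed
  have "norm (multi_deriv \<alpha> (f * g) x) \<le> (\<Sum>(\<beta>, \<gamma>)\<leftarrow>L. norm (multi_deriv \<beta> f x * multi_deriv \<gamma> g x))"
  proof -
    have "norm (multi_deriv \<alpha> (f * g) x) =
        norm (sum_list (map (\<lambda>(\<beta>, \<gamma>). multi_deriv \<beta> f x * multi_deriv \<gamma> g x) L))"
      unfolding L(3) sum_apply by (simp add: o_def case_prod_unfold)
    also have "\<dots> \<le> (\<Sum>z\<leftarrow>map (\<lambda>(\<beta>, \<gamma>). multi_deriv \<beta> f x * multi_deriv \<gamma> g x) L. norm z)"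
      by (induction L) (auto intro: order_trans [OF norm_triangle_ineq])
    finally show ?thesis by (simp add: o_def case_prod_unfold)
  qed
  then have "norm (multi_deriv \<alpha> (f * g) x) * (e (n' + n) * ?W ?k) \<le>
      (\<Sum>(\<beta>, \<gamma>)\<leftarrow>L. norm (multi_deriv \<beta> f x * multi_deriv \<gamma> g x)) * (e (n' + n) * ?W ?k)"
    by (intro mult_right_mono) (auto simp: conj_weight_nonneg e_def)
  also have "\<dots> = (\<Sum>(\<beta>, \<gamma>)\<leftarrow>L. norm (multi_deriv \<beta> f x * multi_deriv \<gamma> g x) * (e (n' + n) * ?W ?k))"
    by (simp add: sum_list_mult_const case_prod_unfold)
  also have "\<dots> \<le> (\<Sum>_\<leftarrow>L. C * D)"
    using summand by (intro sum_list_mono) auto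
  also have "\<dots> = 2 ^ ?k * (C * D)"
    by (simp add: sum_list_triv L(1))
  finally have main: "norm (multi_deriv \<alpha> (f * g) x) * (e (n' + n) * ?W ?k) \<le> 2 ^ ?k * (C * D)" .
  \<comment> \<open>The claim is multiplied by 2^k so that doubling applies on the left; the same
    factor from \<open>main\<close> then cancels.\<close>
  have "2 ^ ?k * (norm (multi_deriv \<alpha> (f * g) x) * (e (n' + n) * conj_weight \<omega> m ?k)) =
      norm (multi_deriv \<alpha> (f * g) x) * e (n' + n) * (2 ^ ?k * conj_weight \<omega> m ?k)"
    by simp
  also have "\<dots> \<le> norm (multi_deriv \<alpha> (f * g) x) * e (n' + n) * (exp (real (m * K)) * ?W ?k)"
    using conj_weight_doubling [where \<omega> = \<omega>, OF K] by (intro mult_left_mono) (auto simp: e_def)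
  also have "\<dots> = exp (real (m * K)) * (norm (multi_deriv \<alpha> (f * g) x) * (e (n' + n) * ?W ?k))"
    by simp
  also have "\<dots> \<le> exp (real (m * K)) * (2 ^ ?k * (C * D))"
    using main by (intro mult_left_mono) auto
  also have "\<dots> = 2 ^ ?k * (exp (real (m * K)) * C * D)" by simp
  finally have "norm (multi_deriv \<alpha> (f * g) x) * (e (n' + n) * conj_weight \<omega> m ?k) \<le>
      exp (real (m * K)) * C * D"
    by (simp only: mult_le_cancel_left_pos zero_less_power zero_less_numeral)
  then show "norm (multi_deriv \<alpha> (f * g) x) *
      (exp (- (real (n' + n) * \<omega> (norm x))) * conj_weight \<omega> m ?k) \<le> exp (real (m * K)) * C * D"
    by (simp add: e_def)
qed

section \<open>Linear structure of the steps and multiplication between them\<close>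

lemma O_step_mono:
  assumes "m \<ge> 1" "n \<le> n'" and pos: "\<And>t. t \<ge> 0 \<Longrightarrow> \<omega> t \<ge> 0"
  shows "O_step \<omega> m n \<subseteq> O_step \<omega> m n'"
proof
  fix f :: "real ^ 'a \<Rightarrow> complex" assume "f \<in> O_step \<omega> m n"
  then obtain C where f: "smooth f" "O_bound \<omega> m n C f" using O_step_iff [OF assms(1)] by blast
  have "O_bound \<omega> m n' C f"
    unfolding O_bound_def
  proof (intro allI)
    fix \<alpha> :: "'a \<Rightarrow> nat" and x :: "real ^ 'a"
    have "real n * \<omega> (norm x) \<le> real n' * \<omega> (norm x)"
      using assms(2) pos by (intro mult_right_mono) auto
    then have "norm (multi_deriv \<alpha> f x) * (exp (- (real n' * \<omega> (norm x))) * conj_weight \<omega> m (multi_order \<alpha>)) \<le>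
        norm (multi_deriv \<alpha> f x) * (exp (- (real n * \<omega> (norm x))) * conj_weight \<omega> m (multi_order \<alpha>))"
      by (intro mult_left_mono mult_right_mono) (auto simp: conj_weight_nonneg)
    also have "\<dots> \<le> C" using f(2) unfolding O_bound_def by blast
    finally show "norm (multi_deriv \<alpha> f x) *
        (exp (- (real n' * \<omega> (norm x))) * conj_weight \<omega> m (multi_order \<alpha>)) \<le> C" .
  qed
  then show "f \<in> O_step \<omega> m n'" using f(1) O_step_iff [OF assms(1)] by blast
qed

lemma O_step_add:
  "m \<ge> 1 \<Longrightarrow> f \<in> O_step \<omega> m n \<Longrightarrow> g \<in> O_step \<omega> m n \<Longrightarrow> f + g \<in> O_step \<omega> m n"
  using O_bound_add smooth_add unfolding O_step_iff by blast

lemma O_step_scale: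
  assumes "m \<ge> 1" "f \<in> O_step \<omega> m n"
  shows "(\<lambda>x. c * f x) \<in> O_step \<omega> m n"
proof -
  obtain C where f: "smooth f" "O_bound \<omega> m n C f" using assms O_step_iff by blast
  have "norm c * (norm (multi_deriv \<alpha> f x) *
      (exp (- (real n * \<omega> (norm x))) * conj_weight \<omega> m (multi_order \<alpha>))) \<le> norm c * C" for \<alpha> x
    using f(2) unfolding O_bound_def by (intro mult_left_mono) auto
  then have "O_bound \<omega> m n (norm c * C) (\<lambda>x. c * f x)"
    unfolding O_bound_def by (simp add: multi_deriv_scale f norm_mult mult.assoc)
  moreover have "smooth (\<lambda>x. c * f x)"
    using smooth_mult [OF smooth_const f(1), of c] by (simp add: times_fun_def)
  ultimately show ?thesis using O_step_iff [OF assms(1)] by blast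
qed

lemma O_step_const:
  assumes "m \<ge> 1" "\<omega> 1 = 0" "\<And>t. t \<ge> 0 \<Longrightarrow> \<omega> t \<ge> 0"
  shows "(\<lambda>_. c) \<in> O_step \<omega> m n"
  using O_bound_const [where \<omega> = \<omega>, OF assms(2,3)] smooth_const unfolding O_step_iff [OF assms(1)] by blast

lemma fun_subspace_diff:
  assumes "fun_subspace V" "f \<in> V" "g \<in> V"
  shows "f - g \<in> V"
proof -
  have "f + (\<lambda>x. - 1 * g x) \<in> V" using assms unfolding fun_subspace_def by blast
  moreover have "f + (\<lambda>x. - 1 * g x) = f - g" by (auto simp: fun_eq_iff)
  ultimately show ?thesis by simp
qed

lemma fun_subspace_O_step:
  assumes "m \<ge> 1" "\<omega> 1 = 0" "\<And>t. t \<ge> 0 \<Longrightarrow> \<omega> t \<ge> 0"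
  shows "fun_subspace (O_step \<omega> m n)"
  unfolding fun_subspace_def zero_fun_def
  using O_step_const [where \<omega> = \<omega>, OF assms] O_step_add [OF assms(1)] O_step_scale [OF assms(1)] by blast

lemma continuous_map_O_step_mult:
  assumes m: "m \<ge> 1" "K \<ge> 1" and f: "f \<in> O_step \<omega> (m * K) n"
    and K: "\<And>t. t \<ge> 0 \<Longrightarrow> \<omega> (2 * t) \<le> real K * (1 + \<omega> t)"
    and "\<omega> 1 = 0" and pos: "\<And>t. t \<ge> 0 \<Longrightarrow> \<omega> t \<ge> 0"
  shows "continuous_map (O_step_top \<omega> (m * K) n') (O_step_top \<omega> m (n' + n)) ((*) f)"
  unfolding O_step_top_def
proof (rule continuous_map_seminorm_topology)
  have mK: "m * K \<ge> 1" using m by simp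
  obtain C where C: "smooth f" "O_bound \<omega> (m * K) n C f" using f O_step_iff [OF mK] by blast
  note mult = O_bound_mult [OF C _ _ K pos]
  show "f * g \<in> O_step \<omega> m (n' + n)" if "g \<in> O_step \<omega> (m * K) n'" for g
    using that mult smooth_mult [OF C(1)] unfolding O_step_iff [OF mK] O_step_iff [OF m(1)] by blast
  fix q :: "(real ^ 'a \<Rightarrow> complex) \<Rightarrow> real"
  assume q: "q \<in> {\<lambda>g. real_of_ereal (O_norm \<omega> m (n' + n) g)}"
  let ?p = "\<lambda>g :: real ^ 'a \<Rightarrow> complex. real_of_ereal (O_norm \<omega> (m * K) n' g)"
  let ?E = "exp (real (m * K)) * C"
  \<comment> \<open>The added 1 makes the constant positive even when C = 0.\<close>
  have "q (f * g - f * h) \<le> (?E + 1) * ?p (g - h)"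
    if "g \<in> O_step \<omega> (m * K) n'" "h \<in> O_step \<omega> (m * K) n'" for g h
  proof -
    have gh: "g - h \<in> O_step \<omega> (m * K) n'"
      by (rule fun_subspace_diff [OF fun_subspace_O_step]) (use mK that assms(5) pos in auto)
    then have b: "O_bound \<omega> (m * K) n' (?p (g - h)) (g - h)" by (rule O_bound_O_norm [OF mK])
    have "smooth (g - h)" using gh O_step_iff [OF mK] by blast
    then have "O_bound \<omega> m (n' + n) (?E * ?p (g - h)) (f * (g - h))" using b by (rule mult)
    then have "q (f * (g - h)) \<le> ?E * ?p (g - h)" using q O_norm_le_real [OF m(1)] by simp
    also have "\<dots> \<le> (?E + 1) * ?p (g - h)"
      using O_bound_nonneg [OF b] by (simp add: distrib_right)
    finally show ?thesis by (simp add: right_diff_distrib)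
  qed
  moreover have "?E + 1 > 0" using O_bound_nonneg [OF C(2)] by (simp add: add_nonneg_pos)
  ultimately show "\<exists>p\<in>{?p}. \<exists>C>0. \<forall>g\<in>O_step \<omega> (m * K) n'. \<forall>h\<in>O_step \<omega> (m * K) n'.
      q (f * g - f * h) \<le> C * p (g - h)"
    by (intro bexI [of _ ?p] exI [of _ "?E + 1"]) auto
qed

lemma fun_subspace_UN_incseq:
  fixes V :: "nat \<Rightarrow> ('a \<Rightarrow> complex) set"
  assumes V: "\<And>n. n \<ge> 1 \<Longrightarrow> fun_subspace (V n)" and mono: "\<And>n n'. n \<le> n' \<Longrightarrow> V n \<subseteq> V n'"
  shows "fun_subspace (\<Union>n\<in>{1..}. V n)"
  unfolding fun_subspace_def
proof (intro conjI ballI allI)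
  show "0 \<in> (\<Union>n\<in>{1..}. V n)" using V [of 1] by (auto simp: fun_subspace_def)
next
  fix f g assume "f \<in> (\<Union>n\<in>{1..}. V n)" "g \<in> (\<Union>n\<in>{1..}. V n)"
  then obtain n n' where n: "n \<ge> 1" "f \<in> V n" "g \<in> V n'" by auto
  then have "f \<in> V (max n n')" "g \<in> V (max n n')"
    using mono [of n "max n n'"] mono [of n' "max n n'"] by auto
  then have "f + g \<in> V (max n n')"
    using V [of "max n n'"] n(1) by (auto simp: fun_subspace_def)
  then show "f + g \<in> (\<Union>n\<in>{1..}. V n)" using n(1) by force
next
  fix c f assume "f \<in> (\<Union>n\<in>{1..}. V n)"
  then show "(\<lambda>x. c * f x) \<in> (\<Union>n\<in>{1..}. V n)" using V by (fastforce simp: fun_subspace_def)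
qed

lemma fun_subspace_INT: "(\<And>i. i \<in> I \<Longrightarrow> fun_subspace (V i)) \<Longrightarrow> fun_subspace (\<Inter>i\<in>I. V i)"
  by (auto simp: fun_subspace_def)

section \<open>The limit spaces of a fixed weight\<close>

context
  fixes \<omega> :: "real \<Rightarrow> real"
  assumes weight: "nonquasianalytic_weight \<omega>"
begin

lemma weight_nonneg: "t \<ge> 0 \<Longrightarrow> \<omega> t \<ge> 0"
  using weight by (simp add: nonquasianalytic_weight_def)

lemma weight_1: "\<omega> 1 = 0"
  using weight by (simp add: nonquasianalytic_weight_def)

lemma weight_mono: "0 \<le> s \<Longrightarrow> s \<le> t \<Longrightarrow> \<omega> s \<le> \<omega> t"
  using weight by (auto simp: nonquasianalytic_weight_def intro: mono_onD)

text \<open>K becomes a factor of the index \<open>m\<close>, so it is rounded up to a natural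
  number.\<close>

lemma weight_doublingE:
  obtains K :: nat where "K \<ge> 1" "\<And>t. t \<ge> 0 \<Longrightarrow> \<omega> (2 * t) \<le> real K * (1 + \<omega> t)"
proof -
  obtain K where K: "K \<ge> 1" "\<And>t. t \<ge> 0 \<Longrightarrow> \<omega> (2 * t) \<le> K * (1 + \<omega> t)"
    using weight by (auto simp: nonquasianalytic_weight_def)
  have "\<omega> (2 * t) \<le> real (nat \<lceil>K\<rceil>) * (1 + \<omega> t)" if "t \<ge> 0" for t
  proof -
    have "K * (1 + \<omega> t) \<le> real (nat \<lceil>K\<rceil>) * (1 + \<omega> t)"
      using weight_nonneg [OF that] by (intro mult_right_mono) (auto simp: real_nat_ceiling_ge)
    then show ?thesis using K(2) [OF that] by linarith
  qed
  moreover have "nat \<lceil>K\<rceil> \<ge> 1" using K(1) by linarith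
  ultimately show ?thesis using that by blast
qed

lemma fun_subspace_OM: "fun_subspace (OM_space \<omega>)"
  unfolding OM_space_def
  by (intro fun_subspace_INT fun_subspace_UN_incseq fun_subspace_O_step O_step_mono)
    (auto simp: weight_1 weight_nonneg)

lemma fun_subspace_OC: "fun_subspace (OC_space \<omega>)"
  unfolding OC_space_def
proof (intro fun_subspace_UN_incseq fun_subspace_INT fun_subspace_O_step)
  show "(\<Inter>m\<in>{1..}. O_step \<omega> m n) \<subseteq> (\<Inter>m\<in>{1..}. O_step \<omega> m n')" if "n \<le> n'" for n n'
    using that by (intro INT_anti_mono O_step_mono) (auto simp: weight_nonneg)
qed (auto simp: weight_1 weight_nonneg)

lemma const_in_OC: "(\<lambda>_. c) \<in> OC_space \<omega>"
  unfolding OC_space_def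
  by (intro UN_I [of 1] INT_I O_step_const) (auto simp: weight_1 weight_nonneg)

lemma OC_subset_OM: "OC_space \<omega> \<subseteq> OM_space \<omega>"
  unfolding OC_space_def OM_space_def by blast

text \<open>On a compact set of radius R the growth factor is at most exp (n
  \<open>\<omega>\<close>(R)) by monotonicity. The inclusion is needed because multipliers are
  sought inside \<open>E_space\<close>.\<close>

lemma OM_subset_E: "OM_space \<omega> \<subseteq> E_space \<omega>"
proof
  fix f :: "real ^ 'a \<Rightarrow> complex" assume f: "f \<in> OM_space \<omega>"
  have ex: "\<exists>n C. smooth f \<and> O_bound \<omega> m n C f" if "m \<ge> 1" for m
  proof -
    obtain n where "f \<in> O_step \<omega> m n" using f \<open>m \<ge> 1\<close> unfolding OM_space_def by auto
    then show ?thesis using O_step_iff [OF that] by blast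
  qed
  have "E_seminorm \<omega> A m f < \<infinity>" if A: "compact A" and m: "m \<ge> 1" for A m
  proof -
    obtain n C where C: "O_bound \<omega> m n C f" using ex [OF m] by blast
    obtain R where R: "\<And>x. x \<in> A \<Longrightarrow> norm x \<le> R"
      using compact_imp_bounded [OF A] unfolding bounded_iff by blast
    have eq: "exp_ereal (- (ereal (real m) * young_conj \<omega> (real k / real m))) = ereal (conj_weight \<omega> m k)" for k
      using exp_young_conj [OF m, of 0 \<omega> k] by (simp add: zero_ereal_def [symmetric])
    have "norm (multi_deriv \<alpha> f x) * conj_weight \<omega> m (multi_order \<alpha>) \<le> exp (real n * \<omega> R) * C"
      if x: "x \<in> A" for \<alpha> x
    proof -
      have "norm (multi_deriv \<alpha> f x) * conj_weight \<omega> m (multi_order \<alpha>) = exp (real n * \<omega> (norm x)) *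
          (norm (multi_deriv \<alpha> f x) * (exp (- (real n * \<omega> (norm x))) * conj_weight \<omega> m (multi_order \<alpha>)))"
        by (simp add: exp_minus)
      also have "\<dots> \<le> exp (real n * \<omega> R) * C"
        using C R [OF x] unfolding O_bound_def
        by (intro mult_mono) (auto intro!: mult_left_mono weight_mono simp: conj_weight_nonneg)
      finally show ?thesis .
    qed
    then have "E_seminorm \<omega> A m f \<le> ereal (exp (real n * \<omega> R) * C)"
      unfolding E_seminorm_def eq by (intro SUP_least) simp
    then show ?thesis by (rule le_less_trans) simp
  qed
  then show "f \<in> E_space \<omega>" using ex [of 1] unfolding E_space_def by auto
qed

lemma continuous_map_OM_mult:
  assumes f: "f \<in> OM_space \<omega>"
  shows "continuous_map (OM_top \<omega>) (OM_top \<omega>) ((*) f)"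
proof -
  obtain K :: nat where K: "K \<ge> 1" "\<And>t. t \<ge> 0 \<Longrightarrow> \<omega> (2 * t) \<le> real K * (1 + \<omega> t)"
    using weight_doublingE by blast
  let ?X = "\<lambda>m. lc_ind_lim {1..} (\<lambda>n. O_step_top \<omega> m n :: (real ^ 'a \<Rightarrow> complex) topology)"
  have "continuous_map (OM_top \<omega>) (?X m) ((*) f)" if m: "m \<in> {1..}" for m
  proof -
    have mK: "m * K \<in> {1..}" using m K(1) by simp
    \<comment> \<open>Here n depends on m, as membership in O_M permits: the target at this point is
      a single inductive limit.\<close>
    then obtain n where n: "f \<in> O_step \<omega> (m * K) n" using f unfolding OM_space_def by blast
    have "continuous_map (?X (m * K)) (?X m) ((*) f)"
    proof (rule continuous_map_lc_ind_lim_mult)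
      fix n' :: nat assume "n' \<in> {1..}"
      then show "\<exists>j\<in>{1..}. continuous_map (O_step_top \<omega> (m * K) n') (O_step_top \<omega> m j) ((*) f)"
        using continuous_map_O_step_mult [where \<omega> = \<omega>, OF _ K(1) n K(2) weight_1 weight_nonneg, of n'] m
        by (intro bexI [of _ "n' + n"]) auto
    qed
    with continuous_map_proj_lim_component [OF mK, of ?X]
    show ?thesis unfolding OM_top_def
      using continuous_map_compose by fastforce
  qed
  then show ?thesis
    by (subst (2) OM_top_def, intro continuous_map_into_proj_lim) auto
qed

lemma continuous_map_OC_mult:
  assumes f: "f \<in> OC_space \<omega>"
  shows "continuous_map (OC_top \<omega>) (OC_top \<omega>) ((*) f)"
  unfolding OC_top_def
proof (rule continuous_map_lc_ind_lim_mult)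
  obtain K :: nat where K: "K \<ge> 1" "\<And>t. t \<ge> 0 \<Longrightarrow> \<omega> (2 * t) \<le> real K * (1 + \<omega> t)"
    using weight_doublingE by blast
  \<comment> \<open>One n for all m: the target step \<open>n' + n\<close> has to be fixed before
    the projective limit over m is entered.\<close>
  obtain n where n: "\<And>m. m \<ge> 1 \<Longrightarrow> f \<in> O_step \<omega> m n" using f unfolding OC_space_def by auto
  let ?X = "\<lambda>n m. O_step_top \<omega> m n :: (real ^ 'a \<Rightarrow> complex) topology"
  fix n' :: nat assume n': "n' \<in> {1..}"
  have "continuous_map (proj_lim {1..} (?X n')) (?X (n' + n) m) ((*) f)" if m: "m \<in> {1..}" for m
  proof -
    have mK: "m * K \<in> {1..}" using m K(1) by simp
    then have "continuous_map (?X n' (m * K)) (?X (n' + n) m) ((*) f)"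
      using m n by (intro continuous_map_O_step_mult K weight_1 weight_nonneg) auto
    with continuous_map_proj_lim_component [OF mK, of "?X n'"]
    show ?thesis using continuous_map_compose by fastforce
  qed
  then have "continuous_map (proj_lim {1..} (?X n')) (proj_lim {1..} (?X (n' + n))) ((*) f)"
    by (intro continuous_map_into_proj_lim) auto
  then show "\<exists>j\<in>{1..}. continuous_map (proj_lim {1..} (?X n')) (proj_lim {1..} (?X j)) ((*) f)"
    using n' by (intro bexI [of _ "n' + n"]) auto
qed

end

theorem corollary3p8:
  fixes \<omega> :: "real \<Rightarrow> real"
  assumes "nonquasianalytic_weight \<omega>"
  shows "dual_multipliers \<omega> (OM_top \<omega>) = (OM_space \<omega> :: (real ^ 'n::finite \<Rightarrow> complex) set) \<and>
         dual_multipliers \<omega> (OC_top \<omega>) = (OC_space \<omega> :: (real ^ 'n \<Rightarrow> complex) set)"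
proof -
  have one: "(1 :: real ^ 'n \<Rightarrow> complex) \<in> OC_space \<omega>"
    using const_in_OC [OF assms, of 1] by (simp add: one_fun_def)
  then have "1 \<in> topspace (OM_top \<omega> :: (real ^ 'n \<Rightarrow> complex) topology)"
    "1 \<in> topspace (OC_top \<omega> :: (real ^ 'n \<Rightarrow> complex) topology)"
    using OC_subset_OM [OF assms] by auto
  note in_space = this [THEN in_topspace_if_dual_multiplier [rotated]]
  have "dual_multiplier (OM_top \<omega>) f" if "f \<in> OM_space \<omega>" for f :: "real ^ 'n \<Rightarrow> complex"
    by (rule dual_multiplier_if_continuous)
      (simp_all add: assms that fun_subspace_OM continuous_map_OM_mult)
  moreover have "dual_multiplier (OC_top \<omega>) f" if "f \<in> OC_space \<omega>" for f :: "real ^ 'n \<Rightarrow> complex"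
    by (rule dual_multiplier_if_continuous)
      (simp_all add: assms that fun_subspace_OC continuous_map_OC_mult)
  \<comment> \<open>Multipliers must also lie in \<open>E_space\<close>; for O_C this passes through
    O_M.\<close>
  ultimately show ?thesis
    using in_space OC_subset_OM [OF assms] OM_subset_E [OF assms]
    unfolding dual_multipliers_def by auto
qed

end
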